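(* Let $n\ge 3$ be an integer and let $\phi : GL_n(\mathbb{R}) \to GL_n(\mathbb{R})$ be a map. The following assertions are equivalent. (1) $\phi$ is a local automorphism of the group $GL_n(\mathbb R)$. (2) Either there exist $T \in GL_n(\mathbb{R})$ and a function $f\in \mathcal{LM}_r^1$ such that $$\phi(A) = f(\det A)\, T A T^{-1}\quad\text{for all } A \in GL_n(\mathbb{R}),$$ or there exist $T \in GL_n(\mathbb{R})$ and a function $f\in \mathcal{LM}_r^2$ such that $$\phi(A) = f(\det A)\, T (A^{-1})^t T^{-1}\quad\text{for all } A \in GL_n(\mathbb{R}).$$
   Context: A map $\phi: G\to G$ on a group $G$ (no algebraic property or bijectivity assumed) is called a local automorphism of $G$ if for every pair $a,b\in G$ there exists a group automorphism $\phi_{a,b}:G\to G$ (depending on $a,b$) such that $\phi(a)=\phi_{a,b}(a)$ and $\phi(b)=\phi_{a,b}(b)$. Automorphisms are abstract group automorphisms (no continuity assumed). $GL_n(\mathbb R)$ is the group of invertible real $n\times n$ matrices, $A^t$ is the transpose of $A$, and $\mathbb R^*=\mathbb R\setminus\{0\}$ is viewed as a multiplicative group. A function $g:\mathbb R^*\to\mathbb R^*$ is multiplicative if $g(\lambda\mu)=g(\lambda)g(\mu)$ for all $\lambda,\mu$. $\mathcal M_r^1$ is the set of all multiplicative $g:\mathbb R^*\to\mathbb R^*$ such that $\lambda\mapsto g(\lambda)^n\lambda$ is an automorphism of the group $\mathbb R^*$. $\mathcal M_r^2$ is the set of all multiplicative $g:\mathbb R^*\to\mathbb R^*$ such that $\lambda\mapsto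 g(\lambda)^n\lambda^{-1}$ is an automorphism of the group $\mathbb R^*$. For $i\in\{1,2\}$, $\mathcal{LM}_r^i$ is the set of all functions $f:\mathbb R^*\to\mathbb R^*$ such that for all $t,s\in\mathbb R^*$ there exists $g\in\mathcal M_r^i$ with $f(t)=g(t)$ and $f(s)=g(s)$. *)

theory Defs
  imports "HOL-Analysis.Analysis" "HOL-Algebra.Group"
begin

definition GL :: "(real ^ 'n ^ 'n) monoid" where
  "GL = \<lparr>carrier = {A. invertible A}, mult = (**), one = mat 1\<rparr>"

definition Rstar :: "real monoid" where
  "Rstar = \<lparr>carrier = UNIV - {0}, mult = (*), one = 1\<rparr>"

definition local_automorphism :: "('a, 'b) monoid_scheme \<Rightarrow> ('a \<Rightarrow> 'a) \<Rightarrow> bool" where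
  "local_automorphism G \<phi> \<longleftrightarrow> \<phi> \<in> carrier G \<rightarrow> carrier G \<and>
    (\<forall>a\<in>carrier G. \<forall>b\<in>carrier G. \<exists>\<psi>\<in>iso G G. \<phi> a = \<psi> a \<and> \<phi> b = \<psi> b)"

text \<open>
  Functions on the nonzero reals are represented by functions of type \<open>real \<Rightarrow> real\<close>, which are
  constrained only on the carrier of \<^const>\<open>Rstar\<close>; their value at \<open>0\<close> is irrelevant.
\<close>

definition Mr1 :: "nat \<Rightarrow> (real \<Rightarrow> real) set" where
  "Mr1 n = {g \<in> hom Rstar Rstar. (\<lambda>x. g x ^ n * x) \<in> iso Rstar Rstar}"

definition Mr2 :: "nat \<Rightarrow> (real \<Rightarrow> real) set" where
  "Mr2 n = {g \<in> hom Rstar Rstar. (\<lambda>x. g x ^ n * inverse x) \<in> iso Rstar Rstar}"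

definition locally_in :: "(real \<Rightarrow> real) set \<Rightarrow> (real \<Rightarrow> real) set" where
  "locally_in M = {f \<in> carrier Rstar \<rightarrow> carrier Rstar.
    \<forall>t\<in>carrier Rstar. \<forall>s\<in>carrier Rstar. \<exists>g\<in>M. f t = g t \<and> f s = g s}"

definition LMr1 :: "nat \<Rightarrow> (real \<Rightarrow> real) set" where
  "LMr1 n = locally_in (Mr1 n)"

definition LMr2 :: "nat \<Rightarrow> (real \<Rightarrow> real) set" where
  "LMr2 n = locally_in (Mr2 n)"

lemma group_GL: "group (GL :: (real ^ 'n ^ 'n) monoid)"
proof (rule groupI)
  fix A :: "real ^ 'n ^ 'n"
  assume "A \<in> carrier GL"
  then obtain B where "A ** B = mat 1" "B ** A = mat 1"
    by (auto simp: GL_def invertible_def)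
  then show "\<exists>B\<in>carrier GL. B \<otimes>\<^bsub>GL\<^esub> A = \<one>\<^bsub>GL\<^esub>"
    by (auto simp: GL_def invertible_def)
next
  show "\<one>\<^bsub>GL\<^esub> \<in> carrier (GL :: (real ^ 'n ^ 'n) monoid)"
    by (auto simp: GL_def invertible_def intro: exI[of _ "mat 1"])
qed (auto simp: GL_def invertible_mult matrix_mul_assoc)

lemma group_Rstar: "group Rstar"
proof (rule groupI)
  fix x assume "x \<in> carrier Rstar"
  then show "\<exists>y\<in>carrier Rstar. y \<otimes>\<^bsub>Rstar\<^esub> x = \<one>\<^bsub>Rstar\<^esub>"
    by (auto simp: Rstar_def intro!: bexI[of _ "inverse x"])
qed (auto simp: Rstar_def)

end

theory Submission
  imports Defs
begin

text \<open>
  Automorphisms of \<open>GL\<^sub>n(\<real>)\<close> are classified through involutions. The images of the diagonal sign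
  matrices are simultaneously diagonalisable, and counting conjugacy classes shows that, after a
  conjugation, an automorphism maps each reflection to a fixed scalar multiple of itself. It then
  preserves the diagonal torus and maps each root subgroup to itself or, in all cases
  simultaneously, to the opposite one; composing with the contragredient map \<open>A \<mapsto> (A\<^sup>-\<^sup>1)\<^sup>t\<close> excludes
  the second alternative. The commutator relations yield a ring endomorphism of \<open>\<real>\<close>, which is the
  identity, so the automorphism fixes all transvections and is therefore of the form
  \<open>A \<mapsto> g (det A) A\<close>.

  For a local automorphism \<open>\<phi>\<close>, call \<open>A\<close> rigid if traces show that \<open>A\<close> is similar neither to \<open>c A\<close>
  with \<open>c \<noteq> 1\<close> nor to a multiple of the inverse of \<open>A\<close>. Normalise \<open>\<phi>\<close> at a rigid diagonal matrix with
  distinct entries, so that every \<open>\<phi> X\<close> is a multiple of a conjugate of \<open>X\<close> by a diagonal matrix.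
  For rigid \<open>X\<close> and \<open>Z\<close> of the same determinant \<open>t\<close>, the trace of \<open>\<phi> X \<phi> Z\<close> is \<open>f(t)\<^sup>2\<close> times the trace
  of \<open>X Z\<close>, even if \<open>Z\<close> is not rigid. Taking for \<open>X\<close> multiples of diagonal reflection-like matrices and
  their conjugates by transvections, this determines the entries of \<open>\<phi> Z\<close>.
\<close>

section \<open>Matrices over the reals\<close>

lemma matrix_inv_right: "invertible A \<Longrightarrow> A ** matrix_inv A = mat 1"
  and matrix_inv_left: "invertible A \<Longrightarrow> matrix_inv A ** A = mat 1"
  for A :: "real^'n^'n"
proof -
  assume "invertible A"
  then have "\<exists>A'. A ** A' = mat 1 \<and> A' ** A = mat 1" by (auto simp: invertible_def)
  from someI_ex[OF this] show "A ** matrix_inv A = mat 1" "matrix_inv A ** A = mat 1"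
    by (auto simp: matrix_inv_def)
qed

lemma invertible_matrix_inv: "invertible A \<Longrightarrow> invertible (matrix_inv A)" for A :: "real^'n^'n"
  using matrix_inv_left matrix_inv_right unfolding invertible_def by blast

lemma matrix_inv_unique: "A ** B = mat 1 \<Longrightarrow> matrix_inv A = B" for A B :: "real^'n^'n"
  by (metis invertible_right_inverse matrix_inv_left matrix_mul_assoc matrix_mul_lid matrix_mul_rid)

lemma matrix_cancel [simp]:
  fixes A B :: "real^'n^'n"
  assumes "invertible A"
  shows "A ** matrix_inv A = mat 1" "matrix_inv A ** A = mat 1"
    "B ** A ** matrix_inv A = B" "B ** matrix_inv A ** A = B"
  by (simp_all add: assms matrix_inv_left matrix_inv_right flip: matrix_mul_assoc)

lemma matrix_inv_mult:
  fixes A B :: "real^'n^'n"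
  assumes "invertible A" "invertible B"
  shows "matrix_inv (A ** B) = matrix_inv B ** matrix_inv A"
  by (rule matrix_inv_unique) (simp add: matrix_mul_assoc assms)

lemma matrix_inv_inv: "invertible A \<Longrightarrow> matrix_inv (matrix_inv A) = A" for A :: "real^'n^'n"
  by (rule matrix_inv_unique) simp

lemma scaleR_mult_left: "(c *\<^sub>R A) ** B = c *\<^sub>R (A ** B)"
  and scaleR_mult_right: "A ** (c *\<^sub>R B) = c *\<^sub>R (A ** B)"
  for A B :: "real^'n^'n"
  by (simp_all add: vec_eq_iff matrix_matrix_mult_def sum_distrib_left mult_ac)

lemma matrix_inv_scaleR:
  "invertible A \<Longrightarrow> c \<noteq> 0 \<Longrightarrow> matrix_inv (c *\<^sub>R A) = inverse c *\<^sub>R matrix_inv A" for A :: "real^'n^'n"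
  by (rule matrix_inv_unique) (simp add: scaleR_mult_left scaleR_mult_right)

lemma invertible_scaleR: "invertible A \<Longrightarrow> c \<noteq> 0 \<Longrightarrow> invertible (c *\<^sub>R A)" for A :: "real^'n^'n"
  by (rule scalar_invertible)

lemma invertible_mat_1: "invertible (mat 1 :: real^'n^'n)"
  unfolding invertible_def by (rule exI[of _ "mat 1"]) simp

lemma invertible_mult_iff: "invertible (A ** B) \<longleftrightarrow> invertible A \<and> invertible B" for A B :: "real^'n^'n"
  by (simp add: invertible_det_nz det_mul)

lemma det_scaleR: "det (c *\<^sub>R A) = c ^ CARD('n) * det A" for A :: "real^'n^'n"
proof -
  have "c *\<^sub>R A = matrix ((*\<^sub>R) c) ** A"
    by (simp add: matrix_scaleR vec_eq_iff matrix_matrix_mult_def mat_def if_distrib if_distribR cong: if_cong)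
  then show ?thesis by (simp only: det_mul det_matrix_scaleR)
qed

lemma det_matrix_inv: "invertible A \<Longrightarrow> det (matrix_inv A) = inverse (det A)" for A :: "real^'n^'n"
  by (metis det_I det_mul inverse_unique matrix_inv_right)

lemma trace_scaleR: "trace (c *\<^sub>R A) = c * trace A" for A :: "real^'n^'n"
  by (simp add: trace_def sum_distrib_left)

lemma trace_transpose: "trace (transpose A) = trace A" for A :: "real^'n^'n"
  by (simp add: trace_def transpose_def)

lemma transpose_scaleR: "transpose (c *\<^sub>R A) = c *\<^sub>R transpose A" for A :: "real^'n^'n"
  by (simp add: transpose_def vec_eq_iff)

lemma matrix_inv_transpose:
  "invertible A \<Longrightarrow> matrix_inv (transpose A) = transpose (matrix_inv A)" for A :: "real^'n^'n"
  by (rule matrix_inv_unique) (simp flip: matrix_transpose_mul)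

section \<open>Conjugation and the contragredient map\<close>

definition conjm :: "real^'n^'n \<Rightarrow> real^'n^'n \<Rightarrow> real^'n^'n" where
  "conjm T A = T ** A ** matrix_inv T"

definition contragr :: "real^'n^'n \<Rightarrow> real^'n^'n" where
  "contragr A = transpose (matrix_inv A)"

lemma conjm_one [simp]: "conjm (mat 1) A = A" for A :: "real^'n^'n"
  using matrix_inv_unique[of "mat 1 :: real^'n^'n" "mat 1"] by (simp add: conjm_def)

lemma conjm_mult: "invertible T \<Longrightarrow> conjm T (A ** B) = conjm T A ** conjm T B"
  by (simp add: conjm_def matrix_mul_assoc)

lemma conjm_scaleR: "conjm T (c *\<^sub>R A) = c *\<^sub>R conjm T A"
  by (simp add: conjm_def scaleR_mult_left scaleR_mult_right)

lemma conjm_mat_1 [simp]: "invertible T \<Longrightarrow> conjm T (mat 1) = mat 1"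
  by (simp add: conjm_def)

lemma conjm_conjm: "invertible S \<Longrightarrow> invertible T \<Longrightarrow> conjm S (conjm T A) = conjm (S ** T) A"
  by (simp add: conjm_def matrix_mul_assoc matrix_inv_mult)

lemma conjm_inv_cancel [simp]:
  "invertible T \<Longrightarrow> conjm (matrix_inv T) (conjm T A) = A"
  "invertible T \<Longrightarrow> conjm T (conjm (matrix_inv T) A) = A"
  by (simp_all add: conjm_conjm invertible_matrix_inv)

lemma invertible_conjm [simp]: "invertible T \<Longrightarrow> invertible (conjm T A) \<longleftrightarrow> invertible A"
  by (simp add: conjm_def invertible_mult_iff invertible_matrix_inv)

lemma det_conjm [simp]: "invertible T \<Longrightarrow> det (conjm T A) = det A"
  by (simp add: conjm_def det_mul det_matrix_inv) (simp add: invertible_det_nz)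

lemma trace_conjm [simp]: "invertible T \<Longrightarrow> trace (conjm T A) = trace A"
  unfolding conjm_def using trace_mul_sym[of "T ** A" "matrix_inv T"] by (simp add: matrix_mul_assoc)

lemma conjm_matrix_inv: "invertible T \<Longrightarrow> invertible A \<Longrightarrow> matrix_inv (conjm T A) = conjm T (matrix_inv A)"
  by (simp add: conjm_def matrix_inv_mult invertible_mult invertible_matrix_inv matrix_inv_inv matrix_mul_assoc)

lemma conjm_eq_iff: "invertible T \<Longrightarrow> conjm T A = B \<longleftrightarrow> T ** A = B ** T"
  unfolding conjm_def by (metis matrix_cancel(3,4))

lemma invertible_contragr [simp]: "invertible A \<Longrightarrow> invertible (contragr A)"
  by (simp add: contragr_def transpose_invertible invertible_matrix_inv)

lemma contragr_mult: "invertible A \<Longrightarrow> invertible B \<Longrightarrow> contragr (A ** B) = contragr A ** contragr B"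
  by (simp add: contragr_def matrix_inv_mult matrix_transpose_mul)

lemma contragr_scaleR: "invertible A \<Longrightarrow> c \<noteq> 0 \<Longrightarrow> contragr (c *\<^sub>R A) = inverse c *\<^sub>R contragr A"
  by (simp add: contragr_def matrix_inv_scaleR transpose_scaleR)

lemma contragr_contragr [simp]: "invertible A \<Longrightarrow> contragr (contragr A) = A"
  by (simp add: contragr_def matrix_inv_transpose invertible_matrix_inv matrix_inv_inv transpose_transpose)

lemma contragr_conjm:
  "invertible T \<Longrightarrow> invertible A \<Longrightarrow> contragr (conjm T A) = conjm (contragr T) (contragr A)"
  by (simp add: contragr_def conjm_matrix_inv, simp add: conjm_def matrix_transpose_mul
      matrix_inv_transpose invertible_matrix_inv matrix_mul_assoc matrix_inv_inv)

lemma trace_contragr: "trace (contragr A) = trace (matrix_inv A)"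
  by (simp add: contragr_def trace_transpose)

section \<open>Diagonal matrices, transvections and permutation matrices\<close>

definition diagm :: "('n \<Rightarrow> real) \<Rightarrow> real^'n^'n" where
  "diagm d = (\<chi> k l. if k = l then d k else 0)"

text \<open>For \<open>i \<noteq> j\<close> this is the transvection I + a E_ij. The entry is
  overwritten rather than added, which is the shape of the elementary matrices in
  \<open>induct_matrix_elementary\<close>.\<close>

definition transv :: "'n \<Rightarrow> 'n \<Rightarrow> real \<Rightarrow> real^'n^'n" where
  "transv i j a = (\<chi> k l. if k = i \<and> l = j then a else of_bool (k = l))"

definition permm :: "('n \<Rightarrow> 'n) \<Rightarrow> real^'n^'n" where
  "permm p = (\<chi> k l. of_bool (k = p l))"

lemma diagm_nth [simp]: "diagm d $ k $ l = (if k = l then d k else 0)"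
  by (simp add: diagm_def)

lemma transv_nth: "transv i j a $ k $ l = (if k = i \<and> l = j then a else of_bool (k = l))"
  by (simp add: transv_def)

lemma diagm_mult_nth [simp]: "(diagm d ** M) $ k $ l = d k * M $ k $ l"
  by (simp add: matrix_matrix_mult_def if_distrib[of "\<lambda>x. x * _"] if_distribR cong: if_cong)

lemma mult_diagm_nth [simp]: "(M ** diagm d) $ k $ l = M $ k $ l * d l"
  by (simp add: matrix_matrix_mult_def if_distrib[of "\<lambda>x. _ * x"] if_distribR cong: if_cong)

lemma diagm_mult: "diagm d ** diagm e = diagm (\<lambda>i. d i * e i)"
  by (simp add: vec_eq_iff)

lemma diagm_one: "diagm (\<lambda>i. 1) = mat 1"
  by (simp add: vec_eq_iff mat_def)

lemma det_diagm: "det (diagm d :: real^'n^'n) = prod d UNIV"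
  by (subst det_diagonal) auto

lemma trace_diagm: "trace (diagm d :: real^'n^'n) = sum d UNIV"
  by (simp add: trace_def)

lemma invertible_diagm: "invertible (diagm d :: real^'n^'n) \<longleftrightarrow> (\<forall>i. d i \<noteq> 0)"
  by (auto simp: invertible_det_nz det_diagm)

lemma matrix_inv_diagm: "(\<And>i. d i \<noteq> 0) \<Longrightarrow> matrix_inv (diagm d) = diagm (\<lambda>i. inverse (d i))"
  by (rule matrix_inv_unique) (simp add: diagm_mult diagm_one)

lemma diagm_eq_iff: "diagm d = diagm e \<longleftrightarrow> d = e"
  by (auto simp: vec_eq_iff fun_eq_iff)

lemma conjm_diagm_nth: "(\<And>i. d i \<noteq> 0) \<Longrightarrow> conjm (diagm d) A $ i $ j = d i * A $ i $ j / d j"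
  by (simp add: conjm_def matrix_inv_diagm field_simps)

lemma transv_mult_nth:
  "i \<noteq> j \<Longrightarrow> (transv i j a ** M) $ k $ l = M $ k $ l + (if k = i then a * M $ j $ l else 0)"
proof -
  assume ij: "i \<noteq> j"
  have "(transv i j a ** M) $ k $ l = (\<Sum>m\<in>UNIV. (if m = k then M $ m $ l else 0) + (if m = j then (if k = i then a * M $ m $ l else 0) else 0))"
    unfolding matrix_matrix_mult_def by (simp, rule sum.cong) (use ij in \<open>auto simp: transv_nth\<close>)
  then show ?thesis by (simp add: sum.distrib)
qed

lemma mult_transv_nth:
  "i \<noteq> j \<Longrightarrow> (M ** transv i j a) $ k $ l = M $ k $ l + (if l = j then a * M $ k $ i else 0)"
proof -
  assume ij: "i \<noteq> j"
  have "(M ** transv i j a) $ k $ l = (\<Sum>m\<in>UNIV. (if m = l then M $ k $ m else 0) + (if m = i then (if l = j then a * M $ k $ m else 0) else 0))"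
    unfolding matrix_matrix_mult_def by (simp, rule sum.cong) (use ij in \<open>auto simp: transv_nth\<close>)
  then show ?thesis by (simp add: sum.distrib)
qed

lemma transv_mult: "i \<noteq> j \<Longrightarrow> transv i j a ** transv i j b = transv i j (a + b)"
  by (simp add: vec_eq_iff transv_mult_nth) (auto simp: transv_nth)

lemma transv_zero: "i \<noteq> j \<Longrightarrow> transv i j 0 = mat 1"
  by (auto simp: vec_eq_iff transv_nth mat_def)

lemma matrix_inv_transv: "i \<noteq> j \<Longrightarrow> matrix_inv (transv i j a) = transv i j (- a)"
  by (rule matrix_inv_unique) (simp add: transv_mult transv_zero)

lemma invertible_transv: "i \<noteq> j \<Longrightarrow> invertible (transv i j a)"
  unfolding invertible_def by (rule exI[of _ "transv i j (- a)"]) (simp add: transv_mult transv_zero)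

text \<open>Conjugation by the diagonal matrix \<open>diagm h\<close>, with 2 in place
  \<open>i\<close>, squares the transvection, so its determinant equals its own square; being
  nonzero, it is 1.\<close>

lemma det_transv: "i \<noteq> j \<Longrightarrow> det (transv i j a :: real^'n^'n) = 1"
proof -
  assume ij: "i \<noteq> j"
  define h :: "'n \<Rightarrow> real" where "h = (\<lambda>k. if k = i then 2 else 1)"
  have "diagm h ** transv i j a = transv i j a ** transv i j a ** diagm h"
    using ij by (simp add: transv_mult) (auto simp: vec_eq_iff h_def transv_nth)
  then have "det (diagm h) * det (transv i j a) = det (transv i j a) * det (transv i j a) * det (diagm h)"
    by (metis det_mul)
  moreover have "det (diagm h) \<noteq> 0" by (auto simp: det_diagm h_def)
  moreover have "det (transv i j a) \<noteq> 0" using invertible_transv[OF ij] by (simp add: invertible_det_nz)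
  ultimately show ?thesis by simp
qed

lemma transv_eq_iff: "i \<noteq> j \<Longrightarrow> transv i j a = transv i j b \<longleftrightarrow> a = b"
  by (auto simp: vec_eq_iff transv_nth)

lemma contragr_transv: "i \<noteq> j \<Longrightarrow> contragr (transv i j a) = transv j i (- a)"
  by (auto simp: contragr_def matrix_inv_transv transpose_def vec_eq_iff transv_nth)

lemma conjm_diagm_transv:
  "i \<noteq> j \<Longrightarrow> (\<And>k. d k \<noteq> 0) \<Longrightarrow> conjm (diagm d) (transv i j a) = transv i j (d i / d j * a)"
  by (auto simp: vec_eq_iff conjm_diagm_nth transv_nth)

text \<open>The relation [x_ij(a), x_jk(b)] = x_ik(ab), multiplied out so that no inverses occur.
  Through it multiplication of reals becomes visible in the group structure.\<close>

lemma transv_commutator: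
  assumes "i \<noteq> j" "j \<noteq> k" "i \<noteq> k"
  shows "transv i j a ** transv j k b = transv i k (a * b) ** transv j k b ** transv i j a"
  using assms by (simp add: vec_eq_iff transv_mult_nth mult_transv_nth) (auto simp: transv_nth)

lemma eq_bij_iff: "bij p \<Longrightarrow> k = p m \<longleftrightarrow> inv_into UNIV p k = m"
  by (metis bij_inv_eq_iff)

lemma permm_mult_nth: "bij p \<Longrightarrow> (permm p ** M) $ k $ l = M $ (inv_into UNIV p k) $ l"
  by (simp add: matrix_matrix_mult_def permm_def eq_bij_iff of_bool_def if_distrib[of "\<lambda>x. x * _"] cong: if_cong)

lemma mult_permm_nth: "(M ** permm p) $ k $ l = M $ k $ (p l)"
  unfolding matrix_matrix_mult_def permm_def
  by (simp add: of_bool_def if_distrib[of "\<lambda>x. _ * x"] cong: if_cong)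

lemma invertible_permm: "bij p \<Longrightarrow> invertible (permm p :: real^'n^'n)"
proof -
  assume p: "bij p"
  have "permm (inv_into UNIV p) ** permm p = (mat 1 :: real^'n^'n)"
    using p by (simp add: vec_eq_iff mult_permm_nth mat_def) (simp add: permm_def eq_bij_iff bij_is_inj inv_inv_eq bij_is_surj surj_f_inv_f)
  then show ?thesis by (auto simp: invertible_left_inverse)
qed

lemma conjm_permm_diagm: "bij p \<Longrightarrow> conjm (permm p) (diagm d) = diagm (\<lambda>k. d (inv_into UNIV p k))"
  by (simp add: conjm_eq_iff invertible_permm) (simp add: vec_eq_iff permm_mult_nth, simp add: permm_def eq_bij_iff)

section \<open>Automorphisms and reflections\<close>

text \<open>An automorphism of \<open>GL\<close> (see \<open>gl_aut_iff_iso\<close>) as a total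
  function on matrices; its values on singular matrices stay arbitrary.\<close>

locale gl_aut =
  fixes \<psi> :: "real^'n^'n \<Rightarrow> real^'n^'n"
  assumes invertible_image [simp]: "invertible A \<Longrightarrow> invertible (\<psi> A)"
    and mult: "invertible A \<Longrightarrow> invertible B \<Longrightarrow> \<psi> (A ** B) = \<psi> A ** \<psi> B"
    and inj: "invertible A \<Longrightarrow> invertible B \<Longrightarrow> \<psi> A = \<psi> B \<Longrightarrow> A = B"
    and surj: "invertible B \<Longrightarrow> \<exists>A. invertible A \<and> \<psi> A = B"

lemma gl_aut_iff_iso: "gl_aut \<psi> \<longleftrightarrow> \<psi> \<in> iso GL GL"
  unfolding gl_aut_def iso_iff hom_def GL_def inj_on_def image_def Pi_def by fastforce

context gl_aut
begin

lemma one [simp]: "\<psi> (mat 1) = mat 1"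
proof -
  have "\<psi> (mat 1) ** \<psi> (mat 1) = \<psi> (mat 1)"
    by (metis invertible_mat_1 matrix_mul_lid mult)
  then show ?thesis
    by (metis invertible_image invertible_mat_1 matrix_cancel(1,3))
qed

lemma image_matrix_inv: "invertible A \<Longrightarrow> \<psi> (matrix_inv A) = matrix_inv (\<psi> A)"
  by (metis invertible_matrix_inv matrix_inv_right matrix_inv_unique mult one)

lemma image_conjm: "invertible T \<Longrightarrow> invertible A \<Longrightarrow> \<psi> (conjm T A) = conjm (\<psi> T) (\<psi> A)"
  by (simp add: conjm_def mult invertible_mult invertible_matrix_inv image_matrix_inv)

lemma commute_iff:
  "invertible A \<Longrightarrow> invertible B \<Longrightarrow> \<psi> A ** \<psi> B = \<psi> B ** \<psi> A \<longleftrightarrow> A ** B = B ** A"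
  by (metis inj invertible_mult mult)

lemma gl_aut_conjm: "invertible T \<Longrightarrow> gl_aut (\<lambda>A. conjm T (\<psi> A))"
proof
  assume T: "invertible T"
  show "conjm T (\<psi> (A ** B)) = conjm T (\<psi> A) ** conjm T (\<psi> B)"
    if "invertible A" "invertible B" for A B using that T by (simp add: mult conjm_mult)
  show "A = B" if "invertible A" "invertible B" "conjm T (\<psi> A) = conjm T (\<psi> B)" for A B
    by (metis T conjm_inv_cancel(1) inj that)
  show "\<exists>A. invertible A \<and> conjm T (\<psi> A) = B" if "invertible B" for B
    using surj[of "conjm (matrix_inv T) B"] T that
    by (metis conjm_inv_cancel(2) invertible_conjm invertible_matrix_inv)
qed simp

lemma gl_aut_contragr: "gl_aut (\<lambda>A. contragr (\<psi> A))"
proof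
  show "contragr (\<psi> (A ** B)) = contragr (\<psi> A) ** contragr (\<psi> B)"
    if "invertible A" "invertible B" for A B using that by (simp add: mult contragr_mult)
  show "A = B" if "invertible A" "invertible B" "contragr (\<psi> A) = contragr (\<psi> B)" for A B
    by (metis contragr_contragr inj invertible_image that)
  show "\<exists>A. invertible A \<and> contragr (\<psi> A) = B" if "invertible B" for B
    using surj[of "contragr B"] that by (metis contragr_contragr invertible_contragr)
qed simp

end

text \<open>Induction on the family: v is the sum of (v + u v)/2 and (v - u v)/2. Both are
  eigenvectors of the new involution u and, since u commutes with the others, remain joint
  eigenvectors of those.\<close>

lemma joint_eigenvectors_span:
  fixes F :: "(real^'n^'n) set"
  assumes "finite F" and "\<And>u. u \<in> F \<Longrightarrow> u ** u = mat 1"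
    and "\<And>u w. u \<in> F \<Longrightarrow> w \<in> F \<Longrightarrow> u ** w = w ** u"
  shows "span {v. \<forall>u\<in>F. u *v v = v \<or> u *v v = - v} = UNIV"
  using assms
proof (induction F)
  case empty
  then show ?case by simp
next
  case (insert u F)
  let ?E = "\<lambda>F. {v. \<forall>u\<in>F. u *v v = v \<or> u *v v = - v}"
  have "?E F \<subseteq> span (?E (insert u F))"
  proof
    fix v assume v: "v \<in> ?E F"
    have uu: "u *v (u *v v) = v" using insert.prems(1)[of u] by (simp add: matrix_vector_mul_assoc)
    have w: "w *v (u *v v) = u *v (w *v v)" if "w \<in> F" for w
      using insert.prems(2)[of u w] that by (simp add: matrix_vector_mul_assoc)
    have neg: "w *v (- x) = - (w *v x)" for w :: "real^'n^'n" and x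
      by (rule linear_neg) simp
    have "v + u *v v \<in> ?E (insert u F)"
      using v uu by (auto simp: matrix_vector_right_distrib w neg)
    moreover have "v - u *v v \<in> ?E (insert u F)"
      using v uu by (auto simp: matrix_vector_mult_diff_distrib w neg)
    ultimately have "(1/2) *\<^sub>R (v + u *v v) + (1/2) *\<^sub>R (v - u *v v) \<in> span (?E (insert u F))"
      by (intro span_add span_scale span_base)
    moreover have "(1/2) *\<^sub>R (v + u *v v) + (1/2) *\<^sub>R (v - u *v v) = v"
      by (simp add: vec_eq_iff field_simps)
    ultimately show "v \<in> span (?E (insert u F))" by simp
  qed
  then have "span (?E F) \<subseteq> span (?E (insert u F))"
    by (simp add: span_minimal)
  moreover have "span (?E F) = UNIV" using insert by simp
  ultimately show ?case by auto
qed

lemma involutions_simultaneous_diag: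
  fixes F :: "(real^'n^'n) set"
  assumes "finite F" and "\<And>u. u \<in> F \<Longrightarrow> u ** u = mat 1"
    and "\<And>u w. u \<in> F \<Longrightarrow> w \<in> F \<Longrightarrow> u ** w = w ** u"
  shows "\<exists>T. invertible T \<and> (\<forall>u\<in>F. \<exists>d. (\<forall>i. d i = 1 \<or> d i = -1) \<and> conjm T u = diagm d)"
proof -
  let ?E = "{v. \<forall>u\<in>F. u *v v = v \<or> u *v v = - v}"
  have span: "span ?E = UNIV" using joint_eigenvectors_span assms by blast
  obtain B where B: "B \<subseteq> ?E" "independent B" "?E \<subseteq> span B" "card B = dim ?E"
    by (rule basis_exists)
  have spanB: "span B = UNIV"
    using span_mono[OF B(3)] span span_span[of B] by auto
  have "card B = CARD('n)"
    using B(4) span dim_span[of ?E] by (simp add: dim_UNIV)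
  moreover have "finite B" using B(2) by (rule independent_imp_finite)
  ultimately obtain b where b: "bij_betw b (UNIV :: 'n set) B"
    by (metis finite_same_card_bij finite_class.finite_UNIV)
  \<comment> \<open>The columns of \<open>T\<close> form a basis chosen among the joint
    eigenvectors, on which every member of \<open>F\<close> acts by signs; the conjugating matrix
    sought is the inverse of \<open>T\<close>.\<close>
  define T where "T = (\<chi> i j. b j $ i)"
  have col: "column j T = b j" for j by (simp add: T_def column_def vec_eq_iff)
  have "columns T = B" using b col by (auto simp: columns_def bij_betw_def)
  then have T: "invertible T"
    using spanB by (simp add: invertible_right_inverse matrix_right_invertible_span_columns span_vec_eq)
  have "\<exists>d. (\<forall>i. d i = 1 \<or> d i = -1) \<and> conjm (matrix_inv T) u = diagm d" if u: "u \<in> F" for u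
  proof -
    have bE: "u *v b i = b i \<or> u *v b i = - b i" for i
      using B(1) b u by (auto simp: bij_betw_def)
    define d where "d = (\<lambda>i. if u *v b i = b i then 1 else (-1::real))"
    have db: "u *v b i = d i *\<^sub>R b i" for i using bE[of i] by (auto simp: d_def)
    have "(u ** T) $ k $ l = (T ** diagm d) $ k $ l" for k l
    proof -
      have "(u ** T) $ k $ l = (u *v b l) $ k"
        by (simp add: matrix_matrix_mult_def matrix_vector_mult_def T_def)
      then show ?thesis by (simp add: db T_def)
    qed
    then have "u ** T = T ** diagm d" by (simp add: vec_eq_iff)
    then have "conjm T (diagm d) = u" using T by (simp add: conjm_eq_iff)
    then have "conjm (matrix_inv T) u = diagm d" using T by auto
    then show ?thesis by (intro exI[of _ d]) (simp add: d_def)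
  qed
  then show ?thesis using T invertible_matrix_inv by blast
qed

section \<open>Diagonal sign matrices and their conjugacy classes\<close>

definition sgm :: "'n set \<Rightarrow> real^'n^'n" where
  "sgm S = diagm (\<lambda>k. if k \<in> S then -1 else 1)"

lemma invertible_sgm [simp]: "invertible (sgm S :: real^'n^'n)"
  by (simp add: sgm_def invertible_diagm)

lemma sgm_square: "sgm S ** sgm S = mat 1"
  by (simp add: sgm_def diagm_mult flip: diagm_one) (simp add: if_distrib cong: if_cong)

lemma sgm_commute: "sgm S ** sgm S' = sgm S' ** sgm S"
  by (simp add: sgm_def diagm_mult mult.commute)

lemma sgm_eq_iff [simp]: "sgm S = sgm S' \<longleftrightarrow> S = S'"
  by (auto simp: sgm_def diagm_eq_iff fun_eq_iff split: if_splits)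

lemma sgm_Compl: "sgm (- S) = (-1) *\<^sub>R sgm S"
  by (simp add: sgm_def vec_eq_iff)

lemma trace_sgm: "trace (sgm S :: real^'n^'n) = real CARD('n) - 2 * real (card S)"
proof -
  have "(\<Sum>k\<in>UNIV. if k \<in> S then -1 else 1) = (\<Sum>k\<in>(UNIV::'n set). 1 - 2 * (if k \<in> S then 1 else (0::real)))"
    by (rule sum.cong) auto
  then show ?thesis
    by (simp add: sgm_def trace_diagm sum_subtractf sum.If_cases flip: sum_distrib_left)
qed

lemma conjm_permm_sgm: "bij p \<Longrightarrow> conjm (permm p) (sgm S) = sgm (p ` S)"
  unfolding sgm_def by (subst conjm_permm_diagm, simp)
    (rule arg_cong[of _ _ diagm], auto simp: fun_eq_iff bij_is_inj bij_is_surj surj_f_inv_f inv_f_f image_iff eq_bij_iff)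

lemma card_Compl_UNIV: "card (- S) = CARD('n) - card S" for S :: "'n::finite set"
  by (simp add: Compl_eq_Diff_UNIV card_Diff_subset)

text \<open>The trace determines the number of entries -1. Conversely, bijections between the two
  sets and between their complements glue to a permutation, whose matrix conjugates one sign matrix
  to the other.\<close>

lemma sgm_conj_iff:
  fixes S S' :: "'n::finite set"
  shows "(\<exists>P.  invertible P \<and> conjm P (sgm S) = sgm S') \<longleftrightarrow> card S = card S'"
proof
  assume "\<exists>P. invertible P \<and> conjm P (sgm S) = sgm S'"
  then have "trace (sgm S) = trace (sgm S')" by (metis trace_conjm)
  then show "card S = card S'" by (simp add: trace_sgm)
next
  assume c: "card S = card S'"
  then have "card (- S) = card (- S')" by (simp add: card_Compl_UNIV)
  then obtain q where q: "bij_betw q (- S) (- S')" using finite_same_card_bij[of "-S" "-S'"] by auto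
  obtain p where p: "bij_betw p S S'" using finite_same_card_bij[of S S'] c by auto
  define r where "r = (\<lambda>k. if k \<in> S then p k else q k)"
  have "bij_betw r (S \<union> - S) (S' \<union> - S')"
    unfolding r_def by (rule bij_betw_disjoint_Un[OF p q]) auto
  then have "bij r" by simp
  moreover have "r ` S = S'" using p by (auto simp: r_def bij_betw_def)
  ultimately show "\<exists>P. invertible P \<and> conjm P (sgm S) = sgm S'"
    using conjm_permm_sgm invertible_permm by metis
qed

text \<open>For 2 \<le> k \<le> n - 2 the binomial coefficient is at least that for k = 2, which
  exceeds n. This identifies the conjugacy class of sign matrices that has as many members as there
  are reflections.\<close>

lemma binomial_eq_self:
  assumes "n choose k = n" "n \<ge> 3" "k \<le> n"
  shows "k = 1 \<or> k = n - 1"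
proof (rule ccontr)
  assume a: "\<not> ?thesis"
  have "k \<noteq> 0" "k \<noteq> n" using assms by (auto intro: Nat.gr0I)
  with a assms have k: "2 \<le> k" "k + 2 \<le> n" by auto
  have "n choose k \<ge> n choose 2"
  proof (cases "2 * k \<le> n")
    case True then show ?thesis using k by (intro binomial_mono) auto
  next
    case False
    then have "n choose (n - k) \<ge> n choose 2" using k by (intro binomial_mono) auto
    then show ?thesis using binomial_symmetric[of k n] assms by simp
  qed
  moreover have "n choose 1 < n choose 2" using k by (intro binomial_strict_mono) auto
  ultimately show False using assms by simp
qed

lemma (in gl_aut) reflections_normal_form:
  assumes n: "CARD('n) \<ge> 3"
  shows "\<exists>T \<epsilon>. invertible T \<and> \<epsilon> \<noteq> 0 \<and> (\<forall>i. conjm T (\<psi> (sgm {i})) = \<epsilon> *\<^sub>R sgm {i})"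
proof -
  have "\<exists>T. invertible T \<and> (\<forall>u\<in>\<psi> ` range sgm. \<exists>d. (\<forall>i. d i = 1 \<or> d i = -1) \<and> conjm T u = diagm d)"
  proof (rule involutions_simultaneous_diag)
    show "u ** u = mat 1" if "u \<in> \<psi> ` range sgm" for u
      using that by (auto simp: sgm_square simp flip: mult)
    show "u ** w = w ** u" if "u \<in> \<psi> ` range sgm" "w \<in> \<psi> ` range sgm" for u w
      using that by (auto simp: commute_iff sgm_commute)
  qed simp
  then obtain T where T: "invertible T"
    and diag: "\<And>S. \<exists>d. (\<forall>i. d i = 1 \<or> d i = -1) \<and> conjm T (\<psi> (sgm S)) = diagm d" by blast
  interpret T: gl_aut "\<lambda>A. conjm T (\<psi> A)" using gl_aut_conjm T .
  have "\<exists>S'. conjm T (\<psi> (sgm S)) = sgm S'" for S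
  proof -
    obtain d where d: "\<And>i. d i = 1 \<or> d i = -1" "conjm T (\<psi> (sgm S)) = diagm d" using diag by blast
    have "d = (\<lambda>k. if k \<in> {k. d k = -1} then -1 else 1)" using d(1) by fastforce
    then show ?thesis using d(2) by (metis sgm_def)
  qed
  then obtain \<theta> where \<theta>: "\<And>S. conjm T (\<psi> (sgm S)) = sgm (\<theta> S)" by metis
  have "inj \<theta>"
  proof (rule injI)
    fix S S' assume "\<theta> S = \<theta> S'"
    then have "conjm T (\<psi> (sgm S)) = conjm T (\<psi> (sgm S'))" by (simp add: \<theta>)
    then show "S = S'" using T.inj[of "sgm S" "sgm S'"] by simp
  qed
  then have "surj \<theta>" by (rule finite_UNIV_inj_surj[OF finite_class.finite_UNIV])
  \<comment> \<open>Equal cardinality means conjugacy by \<open>sgm_conj_iff\<close>, and an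
    automorphism preserves conjugacy in both directions.\<close>
  have card_iff: "card (\<theta> S) = card (\<theta> S') \<longleftrightarrow> card S = card S'" for S S'
    unfolding sgm_conj_iff[symmetric]
  proof safe
    fix P :: "real^'n^'n"
    assume P: "invertible P" "conjm P (sgm S) = sgm S'"
    then have "conjm (conjm T (\<psi> P)) (sgm (\<theta> S)) = sgm (\<theta> S')"
      by (metis T.image_conjm \<theta> invertible_sgm)
    then show "\<exists>P. invertible P \<and> conjm P (sgm (\<theta> S)) = sgm (\<theta> S')"
      using P T.invertible_image by blast
  next
    fix P :: "real^'n^'n"
    assume P: "invertible P" "conjm P (sgm (\<theta> S)) = sgm (\<theta> S')"
    obtain Q where Q: "invertible Q" "conjm T (\<psi> Q) = P" using T.surj P by blast
    then have "conjm T (\<psi> (conjm Q (sgm S))) = conjm T (\<psi> (sgm S'))"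
      using P by (simp add: T.image_conjm \<theta>)
    then have "conjm Q (sgm S) = sgm S'" using T.inj Q(1) by auto
    then show "\<exists>P. invertible P \<and> conjm P (sgm S) = sgm S'" using Q(1) by blast
  qed
  fix o1 :: 'n
  define k where "k = card (\<theta> {o1})"
  \<comment> \<open>The singletons form one conjugacy class, so their images fill the whole class of
    the \<open>k\<close>-sets; comparing the sizes of the two leaves k = 1 or k = n - 1.\<close>
  have "\<theta> ` {S. card S = 1} = {S. card S = k}"
  proof
    show "\<theta> ` {S. card S = 1} \<subseteq> {S. card S = k}"
      unfolding k_def using card_iff by (auto simp: card_1_singleton_iff)
    show "{S. card S = k} \<subseteq> \<theta> ` {S. card S = 1}"
    proof
      fix S :: "'n set" assume "S \<in> {S. card S = k}"
      moreover obtain S0 where "S = \<theta> S0" using \<open>surj \<theta>\<close> by auto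
      ultimately show "S \<in> \<theta> ` {S. card S = 1}"
        unfolding k_def using card_iff[of S0 "{o1}"] by auto
    qed
  qed
  then have "card {S::'n set. card S = 1} = card {S::'n set. card S = k}"
    using \<open>inj \<theta>\<close> by (metis card_image inj_on_subset subset_UNIV)
  then have "CARD('n) = CARD('n) choose k"
    using n_subsets[of "UNIV::'n set" 1] n_subsets[of "UNIV::'n set" k] by simp
  moreover have "k \<le> CARD('n)" unfolding k_def by (simp add: card_mono)
  ultimately have k: "k = 1 \<or> k = CARD('n) - 1" using binomial_eq_self n by metis
  have cardk: "card (\<theta> {i}) = k" for i using card_iff[of "{i}" "{o1}"] by (simp add: k_def)
  have "\<exists>\<sigma> \<epsilon>. \<epsilon> \<noteq> 0 \<and> (\<forall>i. sgm (\<theta> {i}) = \<epsilon> *\<^sub>R sgm {\<sigma> i})"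
  proof (cases "k = 1")
    case True
    then have "\<forall>i. \<exists>j. \<theta> {i} = {j}" using cardk by (metis card_1_singletonE)
    then obtain \<sigma> where "\<And>i. \<theta> {i} = {\<sigma> i}" by metis
    then show ?thesis by (intro exI[of _ \<sigma>] exI[of _ 1]) simp
  next
    case False
    \<comment> \<open>Here k = n - 1, so every image is the negative of a reflection, which gives
      the scalar \<epsilon> = -1.\<close>
    then have "card (- \<theta> {i}) = 1" for i using k n cardk[of i] by (simp add: card_Compl_UNIV)
    then have "\<forall>i. \<exists>j. - \<theta> {i} = {j}" by (metis card_1_singletonE)
    then obtain \<sigma> where "\<And>i. - \<theta> {i} = {\<sigma> i}" by metis
    then have "\<And>i. \<theta> {i} = - {\<sigma> i}" by (metis double_complement)
    then show ?thesis by (intro exI[of _ \<sigma>] exI[of _ "-1"]) (simp add: sgm_Compl)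
  qed
  then obtain \<sigma> \<epsilon> where \<sigma>: "\<epsilon> \<noteq> 0" "\<And>i. sgm (\<theta> {i}) = \<epsilon> *\<^sub>R sgm {\<sigma> i}" by blast
  have "inj \<sigma>"
    by (rule injI) (metis \<open>inj \<theta>\<close> \<sigma>(2) injD sgm_eq_iff singleton_inject)
  then have bij: "bij \<sigma>" by (simp add: bij_def finite_UNIV_inj_surj)
  \<comment> \<open>A further conjugation undoes the permutation \<sigma> of the indices.\<close>
  define P :: "real^'n^'n" where "P = permm (inv_into UNIV \<sigma>)"
  have "invertible P" unfolding P_def by (intro invertible_permm bij_imp_bij_inv bij)
  moreover have "conjm P (conjm T (\<psi> (sgm {i}))) = \<epsilon> *\<^sub>R sgm {i}" for i
    using bij by (simp add: \<theta> \<sigma>(2) conjm_scaleR P_def conjm_permm_sgm bij_imp_bij_inv bij_is_inj)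
  ultimately show ?thesis using T \<sigma>(1) by (metis conjm_conjm invertible_mult)
qed

section \<open>Images of transvections\<close>

lemma mult_nth: "(A ** B) $ k $ l = (\<Sum>m\<in>UNIV. A $ k $ m * B $ m $ l)"
  by (simp add: matrix_matrix_mult_def)

lemma commute_sgm_nth:
  assumes "M ** sgm {k} = sgm {k} ** M" "l \<noteq> k"
  shows "M $ k $ l = 0" "M $ l $ k = 0"
proof -
  have "(M ** sgm {k}) $ r $ c = (sgm {k} ** M) $ r $ c" for r c using assms by simp
  from this[of k l] this[of l k] show "M $ k $ l = 0" "M $ l $ k = 0"
    using assms(2) by (simp_all add: sgm_def)
qed

text \<open>The diagonal matrices are the common centraliser of the reflections. An automorphism
  fixing these up to scalars therefore preserves diagonality.\<close>

lemma diagm_iff_commute: "(\<exists>d. M = diagm d) \<longleftrightarrow> (\<forall>i. M ** sgm {i} = sgm {i} ** M)"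
proof
  assume "\<exists>d. M = diagm d"
  then show "\<forall>i. M ** sgm {i} = sgm {i} ** M" by (auto simp: sgm_def diagm_mult mult.commute)
next
  assume "\<forall>i. M ** sgm {i} = sgm {i} ** M"
  then have "M = diagm (\<lambda>k. M $ k $ k)" by (auto simp: vec_eq_iff intro: commute_sgm_nth(2))
  then show "\<exists>d. M = diagm d" by blast
qed

lemma invertible_row_nonzero: "invertible M \<Longrightarrow> \<exists>l. M $ k $ l \<noteq> 0" for M :: "real^'n^'n"
proof (rule ccontr)
  assume "invertible M" "\<nexists>l. M $ k $ l \<noteq> 0"
  then show False using det_zero_row(1)[of k M] by (simp add: invertible_det_nz row_def vec_eq_iff)
qed

lemma invertible_column_nonzero: "invertible M \<Longrightarrow> \<exists>l. M $ l $ k \<noteq> 0" for M :: "real^'n^'n"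
  using invertible_row_nonzero[of "transpose M" k] by (simp add: transpose_invertible) (simp add: transpose_def)

text \<open>Commutation detects the relative position of two root subgroups: nontrivial elements at
  opposite or adjacent positions do not commute, while positions sharing a row or a column do. This
  is what excludes a mixture of kept and flipped root subgroups.\<close>

lemma transv_not_commute_opposite:
  assumes "i \<noteq> j" "b \<noteq> 0" "c \<noteq> 0"
  shows "transv i j b ** transv j i c \<noteq> transv j i c ** transv i j b"
proof
  assume "transv i j b ** transv j i c = transv j i c ** transv i j b"
  then have "(transv i j b ** transv j i c) $ i $ i = (transv j i c ** transv i j b) $ i $ i" by simp
  then show False using assms by (simp add: transv_mult_nth transv_nth)
qed

lemma transv_not_commute_adjacent:
  assumes "i \<noteq> j" "j \<noteq> k" "i \<noteq> k" "b \<noteq> 0" "c \<noteq> 0"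
  shows "transv i j b ** transv j k c \<noteq> transv j k c ** transv i j b"
proof
  assume "transv i j b ** transv j k c = transv j k c ** transv i j b"
  then have "(transv i j b ** transv j k c) $ i $ k = (transv j k c ** transv i j b) $ i $ k" by simp
  then show False using assms by (simp add: transv_mult_nth transv_nth)
qed

lemma transv_commute_same_row:
  "i \<noteq> j \<Longrightarrow> i \<noteq> k \<Longrightarrow> transv i j b ** transv i k c = transv i k c ** transv i j b"
  by (simp add: vec_eq_iff transv_mult_nth) (auto simp: transv_nth)

lemma transv_commute_same_column:
  "i \<noteq> j \<Longrightarrow> k \<noteq> j \<Longrightarrow> transv i j b ** transv k j c = transv k j c ** transv i j b"
  by (simp add: vec_eq_iff transv_mult_nth) (auto simp: transv_nth)

section \<open>Automorphisms fixing all reflections up to a common scalar\<close>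

locale gl_aut_diag = gl_aut \<psi> for \<psi> :: "real^'n^'n \<Rightarrow> real^'n^'n" +
  fixes \<epsilon> :: real
  assumes card: "CARD('n) \<ge> 3"
    and \<epsilon>: "\<epsilon> \<noteq> 0"
    and reflection: "\<psi> (sgm {i}) = \<epsilon> *\<^sub>R sgm {i}"
begin

lemma commute_sgm_iff:
  assumes "invertible M"
  shows "\<psi> M ** sgm {i} = sgm {i} ** \<psi> M \<longleftrightarrow> M ** sgm {i} = sgm {i} ** M"
  using commute_iff[of M "sgm {i}"] assms \<epsilon>
  by (simp add: reflection scaleR_mult_left scaleR_mult_right)

lemma image_diagm_iff: "invertible M \<Longrightarrow> (\<exists>d. \<psi> M = diagm d) \<longleftrightarrow> (\<exists>d. M = diagm d)"
  by (simp add: diagm_iff_commute commute_sgm_iff)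

lemma image_diagm:
  assumes "\<And>k. d k \<noteq> 0"
  shows "\<exists>e. (\<forall>k. e k \<noteq> 0) \<and> \<psi> (diagm d) = diagm e"
proof -
  have inv: "invertible (diagm d :: real^'n^'n)" using assms by (simp add: invertible_diagm)
  then obtain e where "\<psi> (diagm d) = diagm e" using image_diagm_iff by blast
  then show ?thesis using inv invertible_image[OF inv] by (auto simp: invertible_diagm)
qed

lemma diagm_image:
  assumes "\<And>k. e k \<noteq> 0"
  shows "\<exists>d. (\<forall>k. d k \<noteq> 0) \<and> \<psi> (diagm d) = diagm e"
proof -
  have "invertible (diagm e :: real^'n^'n)" using assms by (simp add: invertible_diagm)
  then obtain M where M: "invertible M" "\<psi> M = diagm e" using surj by blast
  then obtain d where "M = diagm d" using image_diagm_iff by blast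
  then show ?thesis using M by (auto simp: invertible_diagm)
qed

text \<open>
  A transvection \<open>x\<close> commutes with all its conjugates by diagonal matrices and is conjugate to
  \<open>x\<^sup>2\<close> by one of them; both properties are inherited by its image.
\<close>

lemma image_transv_cases:
  assumes ij: "i \<noteq> j" and a: "a \<noteq> 0"
  shows "\<exists>b. b \<noteq> 0 \<and> (\<psi> (transv i j a) = transv i j b \<or> \<psi> (transv i j a) = transv j i b)"
proof -
  define x :: "real^'n^'n" where "x = transv i j a"
  define y where "y = \<psi> x"
  \<comment> \<open>The same \<open>h\<close> serves twice. As an image under \<open>\<psi>\<close>
    it yields \<open>comm\<close>, whose (i, i) entries give \<open>prod0\<close> because 2 and 1/2
    differ; as an argument it squares \<open>x\<close>, which yields \<open>sq\<close>.\<close>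
  define h :: "'n \<Rightarrow> real" where "h = (\<lambda>k. if k = i then 2 else 1)"
  have h: "h k \<noteq> 0" for k by (simp add: h_def)
  have invx: "invertible x" using ij by (simp add: x_def invertible_transv)
  then have invy: "invertible y" by (simp add: y_def)
  \<comment> \<open>\<open>x\<close> commutes with the reflections at indices outside {i, j}, hence
    so does \<open>y\<close>: apart from its diagonal, \<open>y\<close> lives in the block on {i,
    j}.\<close>
  have off: "y $ k $ l = 0" if "k \<noteq> l" "\<not> (k \<in> {i, j} \<and> l \<in> {i, j})" for k l
  proof -
    have "y ** sgm {m} = sgm {m} ** y" if "m \<notin> {i, j}" for m
      unfolding y_def commute_sgm_iff[OF invx] using that
      by (auto simp: vec_eq_iff sgm_def x_def transv_nth)
    then show ?thesis using commute_sgm_nth(1)[of y k l] commute_sgm_nth(2)[of y l k] that by auto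
  qed
  have block: "(A ** B) $ k $ l = A $ k $ i * B $ i $ l + A $ k $ j * B $ j $ l"
    if "k \<in> {i, j}" and A: "\<And>m. m \<notin> {i, j} \<Longrightarrow> A $ k $ m = 0" for A B :: "real^'n^'n" and k l
  proof -
    have "(A ** B) $ k $ l = (\<Sum>m\<in>{i, j}. A $ k $ m * B $ m $ l)"
      unfolding mult_nth using A by (intro sum.mono_neutral_right) auto
    then show ?thesis using ij by simp
  qed
  have comm: "conjm (diagm h) y ** y = y ** conjm (diagm h) y"
  proof -
    obtain d where d: "\<And>k. d k \<noteq> 0" "\<psi> (diagm d) = diagm h" using diagm_image[of h, OF h] by auto
    have "conjm (diagm d) x ** x = x ** conjm (diagm d) x"
      using ij d(1) by (simp add: x_def conjm_diagm_transv transv_mult add.commute)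
    then have "\<psi> (conjm (diagm d) x ** x) = \<psi> (x ** conjm (diagm d) x)" by simp
    then show ?thesis
      using d(1) invx by (simp add: mult image_conjm invertible_diagm d(2) y_def)
  qed
  have prod0: "y $ i $ j * y $ j $ i = 0"
  proof -
    have 1: "(conjm (diagm h) y ** y) $ i $ i = (y ** conjm (diagm h) y) $ i $ i" using comm by simp
    have "(conjm (diagm h) y ** y) $ i $ i = y $ i $ i * y $ i $ i + 2 * y $ i $ j * y $ j $ i"
      using ij h by (subst block) (auto simp: conjm_diagm_nth off, simp add: h_def)
    moreover have "(y ** conjm (diagm h) y) $ i $ i = y $ i $ i * y $ i $ i + y $ i $ j * y $ j $ i / 2"
      using ij h by (subst block) (auto simp: conjm_diagm_nth off, simp add: h_def)
    ultimately show ?thesis using 1 by simp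
  qed
  obtain e where e: "\<And>k. e k \<noteq> 0" "\<psi> (diagm h) = diagm e" using image_diagm[of h, OF h] by auto
  have sq: "y ** y = conjm (diagm e) y"
  proof -
    have "x ** x = conjm (diagm h) x"
      using ij h by (simp add: x_def conjm_diagm_transv transv_mult h_def)
    then have "\<psi> (x ** x) = \<psi> (conjm (diagm h) x)" by simp
    then show ?thesis
      using h invx by (simp add: mult image_conjm invertible_diagm e(2) y_def)
  qed
  have diag_sq: "(y ** y) $ k $ k = y $ k $ k * y $ k $ k" for k
  proof (cases "k \<in> {i, j}")
    case True
    then show ?thesis using prod0 by (subst block) (auto simp: off)
  next
    case False
    have "(y ** y) $ k $ k = (\<Sum>m\<in>{k}. y $ k $ m * y $ m $ k)"
      unfolding mult_nth using False off by (intro sum.mono_neutral_right) auto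
    then show ?thesis by simp
  qed
  have nz: "y $ k $ k \<noteq> 0" for k
  proof
    assume 0: "y $ k $ k = 0"
    have "(\<forall>l. y $ k $ l = 0) \<or> (\<forall>l. y $ l $ k = 0)"
    proof (cases "k \<in> {i, j}")
      case True
      define k' where "k' = (if k = i then j else i)"
      have k': "{i, j} = {k, k'}" "y $ k $ k' * y $ k' $ k = 0"
        using True ij prod0 by (auto simp: k'_def)
      have "y $ k $ l = 0" "y $ l $ k = 0" if "l \<noteq> k" "l \<noteq> k'" for l
        using off[of k l] off[of l k] that k'(1) by auto
      with 0 k'(2) show ?thesis by (metis mult_eq_0_iff)
    next
      case False
      then have "y $ k $ l = 0" for l using off[of k l] 0 by (cases "l = k") auto
      then show ?thesis by blast
    qed
    then show False using invertible_row_nonzero[OF invy] invertible_column_nonzero[OF invy] by metis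
  qed
  \<comment> \<open>Diagonal conjugation leaves diagonal entries unchanged, so \<open>sq\<close> and
    \<open>diag_sq\<close> make each of them idempotent; by \<open>nz\<close> it is 1.\<close>
  have diag: "y $ k $ k = 1" for k
    using diag_sq[of k] nz[of k] e(1) by (simp add: sq conjm_diagm_nth)
  have "y \<noteq> mat 1"
    using inj[of x "mat 1"] invx a transv_eq_iff[OF ij, of a 0]
    by (auto simp: y_def x_def invertible_mat_1 transv_zero[OF ij])
  moreover have "y = mat 1" if "y $ i $ j = 0" "y $ j $ i = 0"
  proof -
    have "y $ k $ l = (mat 1 :: real^'n^'n) $ k $ l" for k l
      using off[of k l] diag[of k] that by (auto simp: mat_def)
    then show ?thesis by (simp add: vec_eq_iff)
  qed
  ultimately have "y $ i $ j \<noteq> 0 \<or> y $ j $ i \<noteq> 0" by blast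
  moreover have "y = transv i j (y $ i $ j)" if "y $ j $ i = 0"
  proof -
    have "y $ k $ l = transv i j (y $ i $ j) $ k $ l" for k l
      using off[of k l] diag[of k] that ij by (auto simp: transv_nth)
    then show ?thesis unfolding vec_eq_iff by blast
  qed
  moreover have "y = transv j i (y $ j $ i)" if "y $ i $ j = 0"
  proof -
    have "y $ k $ l = transv j i (y $ j $ i) $ k $ l" for k l
      using off[of k l] diag[of k] that ij by (auto simp: transv_nth)
    then show ?thesis unfolding vec_eq_iff by blast
  qed
  ultimately show ?thesis using prod0 unfolding y_def x_def by (metis mult_eq_0_iff)
qed

definition upright :: "'n \<Rightarrow> 'n \<Rightarrow> bool" where
  "upright i j \<longleftrightarrow> (\<forall>a. \<exists>b. \<psi> (transv i j a) = transv i j b)"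

text \<open>By \<open>image_transv_cases\<close> each single transvection goes one way or the other.
  Two elements of one root subgroup commute, whereas nontrivial elements of opposite ones do not, so
  the choice cannot depend on \<open>a\<close>.\<close>

lemma upright_or_flipped:
  assumes ij: "i \<noteq> j"
  shows "upright i j \<or> (\<forall>a. \<exists>b. \<psi> (transv i j a) = transv j i b)"
proof (rule ccontr)
  assume "\<not> ?thesis"
  then obtain a a' where a: "\<And>b. \<psi> (transv i j a) \<noteq> transv i j b"
    and a': "\<And>b. \<psi> (transv i j a') \<noteq> transv j i b"
    unfolding upright_def by blast
  have "a \<noteq> 0" "a' \<noteq> 0"
    using a[of 0] a'[of 0] ij by (auto simp: transv_zero)
  then obtain b b' where b: "b \<noteq> 0" "\<psi> (transv i j a) = transv j i b" "b' \<noteq> 0" "\<psi> (transv i j a') = transv i j b'"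
    using image_transv_cases[OF ij] a a' by metis
  have "\<psi> (transv i j a') ** \<psi> (transv i j a) = \<psi> (transv i j a) ** \<psi> (transv i j a')"
    using ij by (simp add: commute_iff invertible_transv transv_mult add.commute)
  then show False using b transv_not_commute_opposite[OF ij] by metis
qed

lemma upright_image: "i \<noteq> j \<Longrightarrow> upright i j \<Longrightarrow> a \<noteq> 0 \<Longrightarrow> \<exists>b. b \<noteq> 0 \<and> \<psi> (transv i j a) = transv i j b"
  unfolding upright_def by (metis inj invertible_mat_1 invertible_transv one transv_eq_iff transv_zero)

lemma not_upright_image:
  assumes "i \<noteq> j" "\<not> upright i j"
  shows "\<exists>b. \<psi> (transv i j a) = transv j i b"
  using upright_or_flipped[OF assms(1)] assms(2) by blast

text \<open>Here and in the next two lemmas, the wrong alternative would put both images into one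
  root subgroup, one column or one row, where they commute, although the original transvections do
  not.\<close>

lemma upright_opposite:
  assumes "i \<noteq> j" "upright i j" shows "upright j i"
proof (rule ccontr)
  assume "\<not> upright j i"
  then obtain c where c: "\<psi> (transv j i 1) = transv i j c" using not_upright_image assms(1) by metis
  obtain b where b: "\<psi> (transv i j 1) = transv i j b" using assms(2) by (auto simp: upright_def)
  have "\<psi> (transv i j 1) ** \<psi> (transv j i 1) = \<psi> (transv j i 1) ** \<psi> (transv i j 1)"
    using assms(1) by (simp add: b c transv_mult add.commute)
  then show False
    using assms(1) transv_not_commute_opposite[of i j 1 1] by (simp add: commute_iff invertible_transv)
qed

lemma upright_next:
  assumes "i \<noteq> j" "j \<noteq> k" "i \<noteq> k" "upright i j" shows "upright j k"
proof (rule ccontr)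
  assume "\<not> upright j k"
  then obtain c where c: "\<psi> (transv j k 1) = transv k j c" using not_upright_image assms(2) by metis
  obtain b where b: "\<psi> (transv i j 1) = transv i j b" using assms(4) by (auto simp: upright_def)
  have "\<psi> (transv i j 1) ** \<psi> (transv j k 1) = \<psi> (transv j k 1) ** \<psi> (transv i j 1)"
    using assms by (simp add: b c transv_commute_same_column)
  then show False
    using assms transv_not_commute_adjacent[of i j k 1 1] by (simp add: commute_iff invertible_transv)
qed

lemma upright_prev:
  assumes "i \<noteq> j" "j \<noteq> k" "i \<noteq> k" "upright i j" shows "upright k i"
proof (rule ccontr)
  assume "\<not> upright k i"
  then obtain c where c: "\<psi> (transv k i 1) = transv i k c" using not_upright_image assms(3) by metis
  obtain b where b: "\<psi> (transv i j 1) = transv i j b" using assms(4) by (auto simp: upright_def)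
  have "\<psi> (transv k i 1) ** \<psi> (transv i j 1) = \<psi> (transv i j 1) ** \<psi> (transv k i 1)"
    using assms by (simp add: b c transv_commute_same_row)
  then show False
    using assms transv_not_commute_adjacent[of k i j 1 1] by (simp add: commute_iff invertible_transv)
qed

text \<open>The route is (i, j), (i, l), (k, l). If l = i, the middle position would lie on the
  diagonal, and the route starts from (j, i) instead.\<close>

lemma upright_all:
  assumes "i \<noteq> j" "upright i j" "k \<noteq> l" shows "upright k l"
proof -
  have row: "upright i' l'" if "i' \<noteq> j'" "upright i' j'" "i' \<noteq> l'" for i' j' l'
    using that upright_next[of j' i' l'] upright_opposite[of i' j'] by (cases "l' = j'") auto
  have col: "upright k' j'" if "i' \<noteq> j'" "upright i' j'" "k' \<noteq> j'" for i' j' k'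
    using that upright_prev[of j' i' k'] upright_opposite[of i' j'] by (cases "k' = i'") auto
  show ?thesis
  proof (cases "l = i")
    case True
    then show ?thesis using upright_opposite[OF assms(1,2)] col[of j i k] assms by auto
  next
    case False
    then show ?thesis using row[of i j l] col[of i l k] assms by auto
  qed
qed

end

text \<open>Nonnegative reals are squares, so \<open>f\<close> is monotone; it fixes the rationals,
  and density leaves no room for a real that is moved.\<close>

lemma real_ring_endomorphism_id:
  fixes f :: "real \<Rightarrow> real"
  assumes add: "\<And>x y. f (x + y) = f x + f y" and mult: "\<And>x y. f (x * y) = f x * f y" and one: "f 1 = 1"
  shows "f x = x"
proof -
  have zero: "f 0 = 0" using add[of 0 0] by simp
  have neg: "f (- x) = - f x" for x using add[of x "-x"] zero by simp
  have diff: "f (x - y) = f x - f y" for x y using add[of x "-y"] neg by simp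
  have nat: "f (real n) = real n" for n by (induction n) (simp_all add: zero add one)
  have int: "f (of_int k) = of_int k" for k
    by (cases k) (use nat neg in \<open>auto simp del: of_nat_Suc\<close>)
  have rat: "f (of_rat q) = of_rat q" for q
  proof -
    obtain a b where q: "q = Fract a b" "b > 0" using quotient_of_unique by (metis Rat_cases)
    then have "f (of_rat q) * of_int b = of_rat q * of_int b"
      using mult[of "of_rat q" "of_int b"] by (simp add: int of_rat_rat)
    then show ?thesis using q by simp
  qed
  have nonneg: "f x \<ge> 0" if "x \<ge> 0" for x
    using mult[of "sqrt x" "sqrt x"] that by (simp add: zero_le_mult_iff linear)
  have mono: "f x \<le> f y" if "x \<le> y" for x y using nonneg[of "y - x"] that by (simp add: diff)
  show ?thesis
  proof (rule ccontr)
    assume "f x \<noteq> x"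
    then consider "f x < x" | "x < f x" by linarith
    then show False
    proof cases
      case 1
      then obtain q where q: "f x < of_rat q" "of_rat q < x" using of_rat_dense by blast
      then show False using mono[of "of_rat q" x] rat[of q] by simp
    next
      case 2
      then obtain q where q: "x < of_rat q" "of_rat q < f x" using of_rat_dense by blast
      then show False using mono[of x "of_rat q"] rat[of q] by simp
    qed
  qed
qed

section \<open>Automorphisms fixing the transvections\<close>

lemma ex_third: "CARD('n) \<ge> 3 \<Longrightarrow> \<exists>k::'n::finite. k \<noteq> i \<and> k \<noteq> j"
proof (rule ccontr)
  assume c: "CARD('n) \<ge> 3" and "\<nexists>k. k \<noteq> i \<and> k \<noteq> j"
  then have "(UNIV :: 'n set) \<subseteq> {i, j}" by auto
  then have "CARD('n) \<le> card {i, j}" by (intro card_mono) auto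
  also have "\<dots> \<le> 2" by (simp add: card_insert_if)
  finally show False using c by simp
qed

text \<open>
  If \<open>\<psi>\<close> maps \<open>transv i j a\<close> to \<open>transv i j (f i j a)\<close>, the commutator relation makes \<open>f\<close>,
  after normalising \<open>f i j 1 = 1\<close> by a diagonal conjugation, independent of \<open>i\<close> and \<open>j\<close> and
  multiplicative, hence a ring endomorphism of the reals.
\<close>

lemma (in gl_aut_diag) fixes_transv:
  assumes up: "\<And>i j. i \<noteq> j \<Longrightarrow> upright i j"
  shows "\<exists>T. invertible T \<and> (\<forall>i j a. i \<noteq> j \<longrightarrow> conjm T (\<psi> (transv i j a)) = transv i j a)"
proof -
  have "\<forall>i j a. \<exists>b. i \<noteq> j \<longrightarrow> \<psi> (transv i j a) = transv i j b"
    using up by (auto simp: upright_def)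
  then obtain f where f: "\<And>i j a. i \<noteq> j \<Longrightarrow> \<psi> (transv i j a) = transv i j (f i j a)" by metis
  have f_add: "f i j (a + b) = f i j a + f i j b" if "i \<noteq> j" for i j a b
  proof -
    have "\<psi> (transv i j (a + b)) = \<psi> (transv i j a) ** \<psi> (transv i j b)"
      using that by (simp add: invertible_transv transv_mult flip: mult)
    then show ?thesis using that by (simp add: f transv_mult transv_eq_iff)
  qed
  have f_mult: "f i k (a * b) = f i j a * f j k b" if d: "i \<noteq> j" "j \<noteq> k" "i \<noteq> k" for i j k a b
  proof -
    have "\<psi> (transv i j a ** transv j k b) = \<psi> (transv i k (a * b) ** transv j k b ** transv i j a)"
      using d by (simp add: transv_commutator)
    then have "transv i k (f i j a * f j k b) ** transv j k (f j k b) ** transv i j (f i j a)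
        = transv i k (f i k (a * b)) ** transv j k (f j k b) ** transv i j (f i j a)"
      using d transv_commutator[OF d, of "f i j a" "f j k b"]
      by (simp add: mult invertible_mult invertible_transv f)
    then have "transv i k (f i j a * f j k b) = transv i k (f i k (a * b))"
      using d by (metis invertible_transv matrix_cancel(3))
    then show ?thesis using d by (simp add: transv_eq_iff)
  qed
  have f1: "f i j 1 \<noteq> 0" if "i \<noteq> j" for i j
    using upright_image[OF that up[OF that], of 1] f[OF that, of 1] that
    by (auto simp: transv_eq_iff)
  fix p :: 'n
  \<comment> \<open>Chosen so that conjugation by \<open>diagm d\<close> normalises row
    \<open>p\<close>, that is, \<open>g p i 1 = 1\<close> for \<open>i \<noteq> p\<close>.\<close>
  define d where "d = (\<lambda>i. if i = p then 1 else f p i 1)"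
  have d: "d i \<noteq> 0" for i using f1 by (simp add: d_def)
  define g where "g = (\<lambda>i j a. d i / d j * f i j a)"
  have g_mult: "g i k (a * b) = g i j a * g j k b" if "i \<noteq> j" "j \<noteq> k" "i \<noteq> k" for i j k a b
    using d[of j] f_mult[OF that] by (simp add: g_def)
  have g1: "g i j 1 = 1" if ij: "i \<noteq> j" for i j
  proof -
    consider "i = p" | "j = p" | "i \<noteq> p" "j \<noteq> p" by blast
    then show ?thesis
    proof cases
      case 1
      then show ?thesis using ij f1[of p j] by (simp add: g_def d_def)
    next
      case 2
      \<comment> \<open>A third index shows that the values of \<open>f\<close> at 1 in opposite
        positions are inverse to each other, which carries the normalisation from row
        \<open>p\<close> to column \<open>p\<close>.\<close>
      obtain k where k: "k \<noteq> i" "k \<noteq> j" using ex_third[OF card] by blast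
      have "f k i 1 = f k j 1 * f j i 1" "f k j 1 = f k i 1 * f i j 1"
        using f_mult[of k j i 1 1] f_mult[of k i j 1 1] k ij by auto
      then have "f j i 1 * f i j 1 = 1" using f1[of k i] k by (simp add: mult_ac)
      then show ?thesis using 2 ij by (simp add: g_def d_def)
    next
      case 3
      then have "f p j 1 = f p i 1 * f i j 1" using f_mult[of p i j 1 1] ij by auto
      then show ?thesis using 3 f1[of p j] by (simp add: g_def d_def)
    qed
  qed
  have g_row: "g i k a = g i j a" if "i \<noteq> j" "i \<noteq> k" for i j k a
    using g_mult[of i j k a 1] g1[of j k] that by (cases "j = k") auto
  have g_col: "g i k a = g j k a" if "i \<noteq> k" "j \<noteq> k" for i j k a
    using g_mult[of i j k 1 a] g1[of i j] that by (cases "i = j") auto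
  have g_id: "g i j a = a" if ij: "i \<noteq> j" for i j a
  proof -
    obtain k where k: "k \<noteq> i" "k \<noteq> j" using ex_third[OF card] by blast
    show ?thesis
    proof (rule real_ring_endomorphism_id[of "g i j"])
      show "g i j (x + y) = g i j x + g i j y" for x y
        using f_add[OF ij] by (simp add: g_def distrib_left add_divide_distrib)
      \<comment> \<open>The commutator relation needs a detour through a third index
        \<open>k\<close>; row and column independence bring both factors back to position (i,
        j).\<close>
      show "g i j (x * y) = g i j x * g i j y" for x y
        using g_mult[of i k j x y] g_row[of i k j x] g_col[of k j i y] k ij by auto
    qed (simp add: g1 ij)
  qed
  have "conjm (diagm d) (\<psi> (transv i j a)) = transv i j a" if "i \<noteq> j" for i j a
    using g_id[OF that, of a] that d by (simp add: f conjm_diagm_transv g_def)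
  then show ?thesis using d by (intro exI[of _ "diagm d"]) (simp add: invertible_diagm)
qed

lemma commute_transv_scalar:
  fixes M :: "real^'n^'n"
  assumes "\<And>i j. i \<noteq> j \<Longrightarrow> M ** transv i j 1 = transv i j 1 ** M"
  shows "\<exists>c. M = c *\<^sub>R mat 1"
proof -
  have e: "M $ k $ l + (if l = j then M $ k $ i else 0) = M $ k $ l + (if k = i then M $ j $ l else 0)"
    if "i \<noteq> j" for i j k l
  proof -
    have "(M ** transv i j 1) $ k $ l = (transv i j 1 ** M) $ k $ l" using assms that by simp
    then show ?thesis by (simp only: transv_mult_nth[OF that] mult_transv_nth[OF that] mult_1)
  qed
  have "M $ k $ l = 0" if "k \<noteq> l" for k l using e[of l k k k] that by simp
  moreover have "M $ k $ k = M $ l $ l" for k l using e[of k l k l] by (cases "k = l") auto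
  ultimately have "M = M $ p $ p *\<^sub>R mat 1" for p
    by (simp add: vec_eq_iff mat_def)
  then show ?thesis by blast
qed

text \<open>Reduces the swap case of \<open>induct_matrix_elementary\<close> to transvections and
  one reflection.\<close>

lemma permm_transposition:
  assumes "m \<noteq> n"
  shows "(\<chi> i j. mat 1 $ i $ Transposition.transpose m n j) =
    transv m n 1 ** transv n m (- 1) ** transv m n 1 ** diagm (\<lambda>k. if k = m then - 1 else (1::real))"
  using assms
  by (simp add: vec_eq_iff mult_transv_nth transv_mult_nth mat_def)
    (auto simp: transv_nth Transposition.transpose_def)

text \<open>For diagonal D, conjugation by \<open>\<psi> D\<close> and by D agree on transvections,
  so D and \<open>\<psi> D\<close> differ by a scalar. Generation by elementary matrices extends
  this to every invertible A. The scalar is multiplicative, invariant under conjugation and 1 on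
  transvections, hence a function of the determinant.\<close>

lemma (in gl_aut) scalar_twist:
  assumes fixed: "\<And>i j a. i \<noteq> j \<Longrightarrow> \<psi> (transv i j a) = transv i j a"
  shows "\<exists>g. (\<forall>x. x \<noteq> 0 \<longrightarrow> g x \<noteq> 0) \<and> (\<forall>x y. x \<noteq> 0 \<longrightarrow> y \<noteq> 0 \<longrightarrow> g (x * y) = g x * g y) \<and>
    (\<forall>A. invertible A \<longrightarrow> \<psi> A = g (det A) *\<^sub>R A)"
proof -
  have diag_scalar: "\<exists>c. \<psi> (diagm d) = c *\<^sub>R diagm d" if d: "\<And>i. d i \<noteq> 0" for d
  proof -
    have inv: "invertible (diagm d :: real^'n^'n)" using d by (simp add: invertible_diagm)
    let ?M = "matrix_inv (diagm d) ** \<psi> (diagm d)"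
    have "?M ** transv i j 1 = transv i j 1 ** ?M" if "i \<noteq> j" for i j
    proof -
      have "conjm (\<psi> (diagm d)) (transv i j 1) = conjm (diagm d) (transv i j 1)"
        using image_conjm[OF inv invertible_transv[OF that, of 1]] that d
        by (simp add: conjm_diagm_transv fixed)
      then have "\<psi> (diagm d) ** transv i j 1 = conjm (diagm d) (transv i j 1) ** \<psi> (diagm d)"
        using inv by (simp add: conjm_eq_iff)
      then show ?thesis
        using inv by (simp add: conjm_def matrix_mul_assoc flip: matrix_mul_assoc[of _ _ "transv i j 1"])
    qed
    then obtain c where "?M = c *\<^sub>R mat 1" using commute_transv_scalar by blast
    then have "diagm d ** ?M = c *\<^sub>R diagm d" by (simp add: scaleR_mult_right)
    then show ?thesis using inv by (auto simp: matrix_mul_assoc)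
  qed
  have scalar: "invertible A \<longrightarrow> (\<exists>c. \<psi> A = c *\<^sub>R A)" for A
  proof (induction A rule: induct_matrix_elementary)
    case (1 A B)
    then show ?case
      by (auto simp: invertible_mult_iff local.mult scaleR_mult_left scaleR_mult_right)
  next
    case (2 A i)
    then show ?case using det_zero_row(1) by (auto simp: invertible_det_nz)
  next
    case (3 A)
    then have A: "A = diagm (\<lambda>k. A $ k $ k)" by (auto simp: vec_eq_iff)
    show ?case
      by (subst (1 2 3) A) (use diag_scalar in \<open>auto simp: invertible_diagm\<close>)
  next
    case (4 m n)
    have "\<exists>c. \<psi> (diagm (\<lambda>k. if k = m then - 1 else 1)) = c *\<^sub>R diagm (\<lambda>k. if k = m then - 1 else 1)"
      by (rule diag_scalar) simp
    then show ?case
      using 4 by (auto simp: permm_transposition local.mult invertible_mult invertible_transv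
        invertible_diagm fixed scaleR_mult_right)
  next
    case (5 m n c)
    have "(\<chi> i j. if i = m \<and> j = n then c else of_bool (i = j)) = transv m n c"
      by (simp add: transv_def)
    then show ?case using fixed[OF 5, of c] by (metis scaleR_one)
  qed
  define \<chi>' where "\<chi>' = (\<lambda>A. SOME c. \<psi> A = c *\<^sub>R A)"
  have \<chi>: "\<psi> A = \<chi>' A *\<^sub>R A" if "invertible A" for A
    unfolding \<chi>'_def using scalar that by (metis (mono_tags, lifting) someI_ex)
  have nonzero: "A \<noteq> 0" if "invertible A" for A :: "real^'n^'n"
    using that invertible_row_nonzero[of A] by auto
  have uniq: "\<chi>' A = c" if "invertible A" "\<psi> A = c *\<^sub>R A" for A c
    using \<chi>[OF that(1)] that nonzero[OF that(1)] by simp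
  have \<chi>_nz: "\<chi>' A \<noteq> 0" if "invertible A" for A
    using \<chi>[OF that] nonzero[OF invertible_image[OF that]] by auto
  have \<chi>_mult: "\<chi>' (A ** B) = \<chi>' A * \<chi>' B" if "invertible A" "invertible B" for A B
    by (rule uniq) (simp_all add: that local.mult invertible_mult scaleR_mult_left scaleR_mult_right
        \<chi>[OF that(1)] \<chi>[OF that(2)])
  have \<chi>_conj: "\<chi>' (conjm P A) = \<chi>' A" if "invertible A" "invertible P" for A P
  proof (rule uniq)
    have "\<psi> (conjm P A) = conjm (\<chi>' P *\<^sub>R P) (\<chi>' A *\<^sub>R A)"
      using that \<chi>[of P] \<chi>[of A] by (simp add: image_conjm)
    then show "\<psi> (conjm P A) = \<chi>' A *\<^sub>R conjm P A"
      using that \<chi>_nz[of P] by (simp add: conjm_def matrix_inv_scaleR scaleR_mult_left scaleR_mult_right)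
  qed (use that in simp)
  have \<chi>_transv: "\<chi>' (transv i j a) = 1" if "i \<noteq> j" for i j a
    by (rule uniq) (use that fixed in \<open>auto simp: invertible_transv\<close>)
  fix p :: 'n
  define e where "e = (\<lambda>(i::'n) x. diagm (\<lambda>k. if k = i then x else (1::real)))"
  define g where "g = (\<lambda>x. \<chi>' (e p x))"
  have e_inv: "invertible (e i x)" if "x \<noteq> 0" for i x using that by (simp add: e_def invertible_diagm)
  have g_nz: "g x \<noteq> 0" if "x \<noteq> 0" for x unfolding g_def by (intro \<chi>_nz e_inv that)
  have e_mult: "e i (x * y) = e i x ** e i y" for i x y
    unfolding e_def diagm_mult by (rule arg_cong[of _ _ diagm]) auto
  have g_mult: "g (x * y) = g x * g y" if "x \<noteq> 0" "y \<noteq> 0" for x y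
    using that by (simp add: g_def e_mult \<chi>_mult e_inv)
  \<comment> \<open>Transposition matrices conjugate \<open>e p x\<close> to \<open>e i x\<close>,
    so the place of the exceptional entry does not matter.\<close>
  have \<chi>_e: "\<chi>' (e i x) = g x" if "x \<noteq> 0" for i x
  proof -
    have bij: "bij (Transposition.transpose p i)" by simp
    have "conjm (permm (Transposition.transpose p i)) (e p x) = e i x"
      unfolding e_def conjm_permm_diagm[OF bij]
      by (rule arg_cong[of _ _ diagm]) (auto simp: fun_eq_iff Transposition.transpose_def)
    then show ?thesis using \<chi>_conj[OF e_inv invertible_permm[OF bij]] that by (metis g_def)
  qed
  have g_one: "g 1 = 1" using g_mult[of 1 1] g_nz[of 1] by simp
  have \<chi>_diagm: "\<chi>' (diagm d) = g (prod d UNIV)" if d: "\<And>i. d i \<noteq> 0" for d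
  proof -
    \<comment> \<open>The diagonal matrix is built up one entry at a time.\<close>
    have "\<chi>' (diagm (\<lambda>k. if k \<in> F then d k else 1)) = g (prod d F)" for F :: "'n set"
    proof (induction F rule: finite_induct[OF finite])
      case 1
      show ?case using uniq[of "mat 1" 1] by (simp add: diagm_one invertible_mat_1 g_one)
    next
      case (2 i F)
      have "diagm (\<lambda>k. if k \<in> insert i F then d k else 1) = e i (d i) ** diagm (\<lambda>k. if k \<in> F then d k else 1)"
        unfolding e_def diagm_mult using 2 by (intro arg_cong[of _ _ diagm]) auto
      moreover have "invertible (diagm (\<lambda>k. if k \<in> F then d k else 1) :: real^'n^'n)"
        using d by (simp add: invertible_diagm)
      moreover have "prod d F \<noteq> 0" using d by simp
      ultimately show ?case using 2 d by (simp add: \<chi>_mult e_inv \<chi>_e g_mult)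
    qed
    from this[of UNIV] show ?thesis by simp
  qed
  have mult_case: "invertible (A ** B) \<longrightarrow> \<chi>' (A ** B) = g (det (A ** B))"
    if "invertible A \<longrightarrow> \<chi>' A = g (det A)" "invertible B \<longrightarrow> \<chi>' B = g (det B)" for A B
    using that by (auto simp: invertible_mult_iff \<chi>_mult det_mul invertible_det_nz g_mult)
  have diag_case: "invertible (diagm d) \<longrightarrow> \<chi>' (diagm d) = g (det (diagm d :: real^'n^'n))" for d
    using \<chi>_diagm by (simp add: invertible_diagm det_diagm)
  have transv_case: "invertible (transv i j a) \<longrightarrow> \<chi>' (transv i j a) = g (det (transv i j a :: real^'n^'n))"
    if "i \<noteq> j" for i j a using that by (simp add: \<chi>_transv det_transv g_one)
  have "invertible A \<longrightarrow> \<chi>' A = g (det A)" for A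
  proof (induction A rule: induct_matrix_elementary)
    case (1 A B)
    then show ?case by (rule mult_case)
  next
    case (2 A i)
    then show ?case using det_zero_row(1) by (auto simp: invertible_det_nz)
  next
    case (3 A)
    then have A: "A = diagm (\<lambda>k. A $ k $ k)" by (auto simp: vec_eq_iff)
    show ?case by (subst (1 2 3) A) (rule diag_case)
  next
    case (4 m n)
    show ?case
      unfolding permm_transposition[OF 4]
      by (intro mult_case diag_case transv_case) (use 4 in auto)
  next
    case (5 m n c)
    have "(\<chi> i j. if i = m \<and> j = n then c else of_bool (i = j)) = transv m n c"
      by (simp add: transv_def)
    then show ?case using transv_case[OF 5, of c] by simp
  qed
  then show ?thesis using g_nz g_mult \<chi> by (intro exI[of _ g]) auto
qed

section \<open>The classification of automorphisms\<close>

lemma (in gl_aut_diag) form_of_upright: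
  assumes ij: "i \<noteq> j" and up: "upright i j"
  shows "\<exists>T g. invertible T \<and> (\<forall>x. x \<noteq> 0 \<longrightarrow> g x \<noteq> 0) \<and>
    (\<forall>x y. x \<noteq> 0 \<longrightarrow> y \<noteq> 0 \<longrightarrow> g (x * y) = g x * g y) \<and>
    (\<forall>A. invertible A \<longrightarrow> \<psi> A = g (det A) *\<^sub>R conjm T A)"
proof -
  obtain T where T: "invertible T"
    and fixed: "\<And>i j a. i \<noteq> j \<Longrightarrow> conjm T (\<psi> (transv i j a)) = transv i j a"
    using fixes_transv upright_all[OF ij up] by metis
  interpret T: gl_aut "\<lambda>A. conjm T (\<psi> A)" using gl_aut_conjm T .
  obtain g where g: "\<forall>x. x \<noteq> 0 \<longrightarrow> g x \<noteq> 0"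
      "\<forall>x y. x \<noteq> 0 \<longrightarrow> y \<noteq> 0 \<longrightarrow> g (x * y) = g x * g y"
      "\<And>A. invertible A \<Longrightarrow> conjm T (\<psi> A) = g (det A) *\<^sub>R A"
    using T.scalar_twist[OF fixed] by blast
  have "\<psi> A = g (det A) *\<^sub>R conjm (matrix_inv T) A" if "invertible A" for A
    using conjm_inv_cancel(1)[OF T, of "\<psi> A"] by (simp add: g(3) that conjm_scaleR)
  then show ?thesis using T g(1,2)
    by (intro exI[of _ "matrix_inv T"] exI[of _ g] conjI) (auto simp: invertible_matrix_inv)
qed

text \<open>After normalising the reflections, one root subgroup decides: either it is kept, or
  composing with the contragredient map makes it so. Undoing the normalising conjugation gives the
  two alternatives.\<close>

lemma (in gl_aut) form_up_to_contragr:
  assumes n: "CARD('n) \<ge> 3"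
  shows "\<exists>T g. invertible T \<and> (\<forall>x. x \<noteq> 0 \<longrightarrow> g x \<noteq> 0) \<and>
    (\<forall>x y. x \<noteq> 0 \<longrightarrow> y \<noteq> 0 \<longrightarrow> g (x * y) = g x * g y) \<and>
    ((\<forall>A. invertible A \<longrightarrow> \<psi> A = g (det A) *\<^sub>R conjm T A) \<or>
     (\<forall>A. invertible A \<longrightarrow> contragr (\<psi> A) = g (det A) *\<^sub>R conjm T A))"
proof -
  obtain T \<epsilon> where T: "invertible T" "\<epsilon> \<noteq> 0" "\<And>i. conjm T (\<psi> (sgm {i})) = \<epsilon> *\<^sub>R sgm {i}"
    using reflections_normal_form[OF n] by blast
  interpret T: gl_aut "\<lambda>A. conjm T (\<psi> A)" using gl_aut_conjm T(1) .
  interpret T: gl_aut_diag "\<lambda>A. conjm T (\<psi> A)" \<epsilon> by unfold_locales (use n T in auto)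
  obtain i :: 'n where True by blast
  obtain j where ij: "j \<noteq> i" using ex_third[OF n] by blast
  show ?thesis
  proof (cases "T.upright j i")
    case True
    obtain S g where S: "invertible S" "\<forall>x. x \<noteq> 0 \<longrightarrow> g x \<noteq> 0"
      "\<forall>x y. x \<noteq> 0 \<longrightarrow> y \<noteq> 0 \<longrightarrow> g (x * y) = g x * g y"
      "\<And>A. invertible A \<Longrightarrow> conjm T (\<psi> A) = g (det A) *\<^sub>R conjm S A"
      using T.form_of_upright[OF ij True] by blast
    have "\<psi> A = g (det A) *\<^sub>R conjm (matrix_inv T ** S) A" if "invertible A" for A
      using conjm_inv_cancel(1)[OF T(1), of "\<psi> A"] T(1) S(1)
      by (simp add: S(4) that conjm_scaleR conjm_conjm invertible_matrix_inv)
    moreover have "invertible (matrix_inv T ** S)"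
      using T(1) S(1) by (simp add: invertible_mult invertible_matrix_inv)
    ultimately show ?thesis using S(2,3)
      by (intro exI[of _ "matrix_inv T ** S"] exI[of _ g] conjI) auto
  next
    case False
    interpret C: gl_aut "\<lambda>A. contragr (conjm T (\<psi> A))" using T.gl_aut_contragr .
    have inv_sgm: "matrix_inv (sgm S) = sgm S" for S :: "'n set"
      by (rule matrix_inv_unique) (rule sgm_square)
    have tr_sgm: "transpose (sgm S) = sgm S" for S :: "'n set"
      by (simp add: transpose_def sgm_def vec_eq_iff)
    \<comment> \<open>Reflections are their own contragredients, so only the scalar \<epsilon> is
      inverted.\<close>
    interpret C: gl_aut_diag "\<lambda>A. contragr (conjm T (\<psi> A))" "inverse \<epsilon>"
      using n T by unfold_locales (auto simp: contragr_scaleR, simp add: contragr_def inv_sgm tr_sgm)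
    \<comment> \<open>The contragredient map interchanges opposite root subgroups and thus undoes
      the flip.\<close>
    have "C.upright j i"
      unfolding C.upright_def using T.not_upright_image[OF ij False] ij contragr_transv by metis
    then obtain S g where S: "invertible S" "\<forall>x. x \<noteq> 0 \<longrightarrow> g x \<noteq> 0"
      "\<forall>x y. x \<noteq> 0 \<longrightarrow> y \<noteq> 0 \<longrightarrow> g (x * y) = g x * g y"
      "\<And>A. invertible A \<Longrightarrow> contragr (conjm T (\<psi> A)) = g (det A) *\<^sub>R conjm S A"
      using C.form_of_upright[OF ij] by blast
    let ?T = "contragr T"
    have T': "invertible ?T" using T(1) by simp
    have "contragr (\<psi> A) = g (det A) *\<^sub>R conjm (matrix_inv ?T ** S) A" if "invertible A" for A
    proof -
      have e: "conjm ?T (contragr (\<psi> A)) = g (det A) *\<^sub>R conjm S A"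
        using S(4)[OF that] T(1) that by (simp add: contragr_conjm)
      have "contragr (\<psi> A) = conjm (matrix_inv ?T) (conjm ?T (contragr (\<psi> A)))" using T' by simp
      then show ?thesis unfolding e using T' S(1) by (simp add: conjm_scaleR conjm_conjm invertible_matrix_inv)
    qed
    moreover have "invertible (matrix_inv ?T ** S)"
      using T' S(1) by (simp add: invertible_mult invertible_matrix_inv)
    ultimately show ?thesis using S(2,3)
      by (intro exI[of _ "matrix_inv ?T ** S"] exI[of _ g] conjI) auto
  qed
qed

section \<open>Multiplicative twists and the automorphisms they define\<close>

lemma iso_Rstar_iff:
  "h \<in> iso Rstar Rstar \<longleftrightarrow> (\<forall>x. x \<noteq> 0 \<longrightarrow> h x \<noteq> 0) \<and>
    (\<forall>x y. x \<noteq> 0 \<longrightarrow> y \<noteq> 0 \<longrightarrow> h (x * y) = h x * h y) \<and>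
    (\<forall>x. x \<noteq> 0 \<longrightarrow> h x = 1 \<longrightarrow> x = 1) \<and> (\<forall>y. y \<noteq> 0 \<longrightarrow> (\<exists>x. x \<noteq> 0 \<and> h x = y))"
  (is "?L \<longleftrightarrow> ?R")
proof
  assume ?L
  then have h: "\<And>x. x \<noteq> 0 \<Longrightarrow> h x \<noteq> 0" "\<And>x y. x \<noteq> 0 \<Longrightarrow> y \<noteq> 0 \<Longrightarrow> h (x * y) = h x * h y"
    "inj_on h (UNIV - {0})" "h ` (UNIV - {0}) = UNIV - {0}"
    by (auto simp: iso_iff hom_def Rstar_def Pi_def)
  have "h 1 = 1" using h(1)[of 1] h(2)[of 1 1] by simp
  then have "x = 1" if "x \<noteq> 0" "h x = 1" for x
    using inj_onD[OF h(3), of x 1] that by simp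
  moreover have "\<exists>x. x \<noteq> 0 \<and> h x = y" if "y \<noteq> 0" for y
  proof -
    have "y \<in> h ` (UNIV - {0})" using that h(4) by simp
    then show ?thesis by auto
  qed
  ultimately show ?R using h(1,2) by blast
next
  assume R: ?R
  from R have nz: "\<forall>x. x \<noteq> 0 \<longrightarrow> h x \<noteq> 0" by (elim conjE)
  from R have onto: "\<forall>y. y \<noteq> 0 \<longrightarrow> (\<exists>x. x \<noteq> 0 \<and> h x = y)" by (elim conjE)
  have "inj_on h (UNIV - {0})"
  proof (rule inj_onI)
    fix x y assume xy: "x \<in> UNIV - {0}" "y \<in> UNIV - {0}" "h x = h y"
    have "h (x / y) * h y = h y" using R xy by (metis DiffE divide_eq_0_iff insertI1 nonzero_eq_divide_eq)
    then have "h (x / y) = 1" using R xy by simp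
    moreover have "x / y \<noteq> 0" using xy by simp
    ultimately have "x / y = 1" using R by blast
    then show "x = y" by simp
  qed
  moreover have "h ` (UNIV - {0}) = UNIV - {0}"
  proof
    show "h ` (UNIV - {0}) \<subseteq> UNIV - {0}" using nz by auto
    show "UNIV - {0} \<subseteq> h ` (UNIV - {0})"
    proof
      fix y :: real assume "y \<in> UNIV - {0}"
      then obtain x where "x \<noteq> 0" "h x = y" using onto by auto
      then show "y \<in> h ` (UNIV - {0})" by blast
    qed
  qed
  moreover have "h \<in> hom Rstar Rstar" using R by (simp add: hom_def Rstar_def)
  ultimately show ?L by (simp add: iso_iff) (simp add: Rstar_def)
qed

lemma hom_Rstar_iff:
  "g \<in> hom Rstar Rstar \<longleftrightarrow> (\<forall>x. x \<noteq> 0 \<longrightarrow> g x \<noteq> 0) \<and>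
    (\<forall>x y. x \<noteq> 0 \<longrightarrow> y \<noteq> 0 \<longrightarrow> g (x * y) = g x * g y)"
  by (simp add: hom_def Rstar_def Pi_def Ball_def)

lemma hom_power_mult_iso_Rstar_iff:
  assumes "g \<in> hom Rstar Rstar" "k \<in> hom Rstar Rstar"
  shows "(\<lambda>x. g x ^ n * k x) \<in> iso Rstar Rstar \<longleftrightarrow>
    (\<forall>x. x \<noteq> 0 \<longrightarrow> g x ^ n * k x = 1 \<longrightarrow> x = 1) \<and> (\<forall>y. y \<noteq> 0 \<longrightarrow> (\<exists>x. x \<noteq> 0 \<and> g x ^ n * k x = y))"
proof -
  have 1: "\<forall>x. x \<noteq> 0 \<longrightarrow> g x ^ n * k x \<noteq> 0"
    using assms by (simp add: hom_Rstar_iff)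
  have 2: "\<forall>x y. x \<noteq> 0 \<longrightarrow> y \<noteq> 0 \<longrightarrow> g (x * y) ^ n * k (x * y) = g x ^ n * k x * (g y ^ n * k y)"
    using assms by (simp add: hom_Rstar_iff power_mult_distrib)
  show ?thesis unfolding iso_Rstar_iff by (insert 1 2, intro iffI conjI; elim conjE; assumption)
qed

lemma Mr1_iff:
  "g \<in> Mr1 n \<longleftrightarrow> g \<in> hom Rstar Rstar \<and>
    (\<forall>x. x \<noteq> 0 \<longrightarrow> g x ^ n * x = 1 \<longrightarrow> x = 1) \<and> (\<forall>y. y \<noteq> 0 \<longrightarrow> (\<exists>x. x \<noteq> 0 \<and> g x ^ n * x = y))"
proof -
  have "(\<lambda>x. x) \<in> hom Rstar Rstar" by (simp add: hom_Rstar_iff)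
  then show ?thesis unfolding Mr1_def using hom_power_mult_iso_Rstar_iff by blast
qed

text \<open>Inversion is an automorphism of the nonzero reals, and g^n x^(-1) is the inverse of
  (1/g)^n x. The second kind of twist is thereby reduced to the first, in parallel with the
  contragredient map on matrices.\<close>

lemma Mr2_iff: "g \<in> Mr2 n \<longleftrightarrow> (\<lambda>x. inverse (g x)) \<in> Mr1 n"
proof -
  have hom: "g \<in> hom Rstar Rstar \<longleftrightarrow> (\<lambda>x. inverse (g x)) \<in> hom Rstar Rstar"
    by (simp add: hom_Rstar_iff) (simp flip: inverse_mult_distrib)
  have "inverse \<in> hom Rstar Rstar" by (simp add: hom_Rstar_iff)
  then have "g \<in> Mr2 n \<longleftrightarrow> g \<in> hom Rstar Rstar \<and>
    (\<forall>x. x \<noteq> 0 \<longrightarrow> g x ^ n * inverse x = 1 \<longrightarrow> x = 1) \<and>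
    (\<forall>y. y \<noteq> 0 \<longrightarrow> (\<exists>x. x \<noteq> 0 \<and> g x ^ n * inverse x = y))"
    unfolding Mr2_def using hom_power_mult_iso_Rstar_iff by blast
  moreover have inv: "g x ^ n * inverse x = inverse (inverse (g x) ^ n * x)" for x
    by (simp add: power_inverse)
  moreover have "(\<forall>y. y \<noteq> 0 \<longrightarrow> (\<exists>x. x \<noteq> 0 \<and> inverse (inverse (g x) ^ n * x) = y)) \<longleftrightarrow>
    (\<forall>y. y \<noteq> 0 \<longrightarrow> (\<exists>x. x \<noteq> 0 \<and> inverse (g x) ^ n * x = y))"
    by (metis inverse_inverse_eq inverse_nonzero_iff_nonzero)
  ultimately show ?thesis unfolding Mr1_iff hom by (simp only: inverse_eq_1_iff)
qed

lemma Mr1_D: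
  assumes "g \<in> Mr1 n"
  shows "x \<noteq> 0 \<Longrightarrow> g x \<noteq> 0" "x \<noteq> 0 \<Longrightarrow> y \<noteq> 0 \<Longrightarrow> g (x * y) = g x * g y"
    "x \<noteq> 0 \<Longrightarrow> g x ^ n * x = 1 \<Longrightarrow> x = 1" "y \<noteq> 0 \<Longrightarrow> \<exists>x. x \<noteq> 0 \<and> g x ^ n * x = y"
proof -
  have a: "\<forall>x. x \<noteq> 0 \<longrightarrow> g x \<noteq> 0" and b: "\<forall>x y. x \<noteq> 0 \<longrightarrow> y \<noteq> 0 \<longrightarrow> g (x * y) = g x * g y"
    and c: "\<forall>x. x \<noteq> 0 \<longrightarrow> g x ^ n * x = 1 \<longrightarrow> x = 1"
    and d: "\<forall>y. y \<noteq> 0 \<longrightarrow> (\<exists>x. x \<noteq> 0 \<and> g x ^ n * x = y)"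
    using assms unfolding Mr1_iff hom_Rstar_iff by - (elim conjE, assumption)+
  show "x \<noteq> 0 \<Longrightarrow> g x \<noteq> 0" using a by auto
  show "x \<noteq> 0 \<Longrightarrow> y \<noteq> 0 \<Longrightarrow> g (x * y) = g x * g y" using b by blast
  show "x \<noteq> 0 \<Longrightarrow> g x ^ n * x = 1 \<Longrightarrow> x = 1" using c by blast
  show "y \<noteq> 0 \<Longrightarrow> \<exists>x. x \<noteq> 0 \<and> g x ^ n * x = y" using d by blast
qed

lemma LMr2_iff: "f \<in> LMr2 n \<longleftrightarrow> (\<lambda>x. inverse (f x)) \<in> LMr1 n"
proof -
  have "(\<exists>g\<in>Mr2 n. f t = g t \<and> f s = g s) \<longleftrightarrow>
    (\<exists>g\<in>Mr1 n. inverse (f t) = g t \<and> inverse (f s) = g s)" for t s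
  proof
    assume "\<exists>g\<in>Mr2 n. f t = g t \<and> f s = g s"
    then show "\<exists>g\<in>Mr1 n. inverse (f t) = g t \<and> inverse (f s) = g s" by (metis Mr2_iff)
  next
    assume "\<exists>g\<in>Mr1 n. inverse (f t) = g t \<and> inverse (f s) = g s"
    then obtain g where "g \<in> Mr1 n" "inverse (f t) = g t" "inverse (f s) = g s" by blast
    then show "\<exists>g\<in>Mr2 n. f t = g t \<and> f s = g s"
      by (intro bexI[of _ "\<lambda>x. inverse (g x)"]) (metis inverse_inverse_eq, simp add: Mr2_iff)
  qed
  then show ?thesis by (auto simp: LMr1_def LMr2_def locally_in_def Rstar_def Pi_def)
qed

text \<open>The determinant of the image is h(det A) for the automorphism h(t) = g(t)^n t.
  Injectivity of h recovers det A, and with it the scalar and A. A preimage of B is found by solving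
  h(x) = det B and then dividing B by g(x).\<close>

lemma gl_aut_scalar_twist:
  fixes T :: "real^'n^'n"
  assumes T: "invertible T" and g: "g \<in> Mr1 CARD('n)"
  shows "gl_aut (\<lambda>A. g (det A) *\<^sub>R conjm T A)"
proof
  note g' = Mr1_D[OF g]
  have det: "det A \<noteq> 0" if "invertible A" for A :: "real^'n^'n" using that by (simp add: invertible_det_nz)
  show "invertible (g (det A) *\<^sub>R conjm T A)" if "invertible A" for A
    using that T g' det by (intro invertible_scaleR) auto
  show m: "g (det (A ** B)) *\<^sub>R conjm T (A ** B) = g (det A) *\<^sub>R conjm T A ** g (det B) *\<^sub>R conjm T B"
    if "invertible A" "invertible B" for A B
    using that T g' det by (simp add: det_mul conjm_mult scaleR_mult_left scaleR_mult_right)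
  show "A = B" if AB: "invertible A" "invertible B" "g (det A) *\<^sub>R conjm T A = g (det B) *\<^sub>R conjm T B" for A B
  proof -
    have "g (det A) ^ CARD('n) * det A = g (det B) ^ CARD('n) * det B"
      using arg_cong[OF AB(3), of det] T by (simp add: det_scaleR)
    moreover have "g (det A) = g (det A / det B) * g (det B)"
      using g' det[OF AB(1)] det[OF AB(2)]
      by (metis divide_eq_0_iff nonzero_eq_divide_eq)
    ultimately have "g (det A / det B) ^ CARD('n) * (det A / det B) = 1"
      using g' det[OF AB(1)] det[OF AB(2)] by (simp add: power_mult_distrib field_simps)
    moreover have "det A / det B \<noteq> 0" using det[OF AB(1)] det[OF AB(2)] by simp
    ultimately have "det A / det B = 1" using g'(3) by blast
    then have "det A = det B" by simp
    then have "conjm T A = conjm T B" using AB g' det[OF AB(1)] by simp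
    then show ?thesis by (metis T conjm_inv_cancel(1))
  qed
  show "\<exists>A. invertible A \<and> g (det A) *\<^sub>R conjm T A = B" if B: "invertible B" for B
  proof -
    obtain x where x: "x \<noteq> 0" "g x ^ CARD('n) * x = det B" using g'(4) det[OF B] by blast
    define A where "A = conjm (matrix_inv T) (inverse (g x) *\<^sub>R B)"
    have gx: "g x \<noteq> 0" using g'(1) x by blast
    have "det A = inverse (g x) ^ CARD('n) * det B"
      using T by (simp add: A_def invertible_matrix_inv det_scaleR)
    also have "\<dots> = x" using gx by (simp add: field_simps power_inverse flip: x(2))
    finally have "det A = x" .
    moreover have "invertible A"
      using T B gx by (simp add: A_def invertible_matrix_inv invertible_scaleR)
    moreover have "g x *\<^sub>R conjm T A = B" using T gx by (simp add: A_def)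
    ultimately show ?thesis by blast
  qed
qed

text \<open>If g(x)^n x = 1, the scalar matrix with entry 1/g(x) has determinant x and is mapped to
  the identity, so x = 1. Surjectivity follows by taking determinants of preimages.\<close>

lemma (in gl_aut) twist_in_Mr1:
  assumes T: "invertible T" and g: "\<forall>x. x \<noteq> 0 \<longrightarrow> g x \<noteq> 0"
      "\<forall>x y. x \<noteq> 0 \<longrightarrow> y \<noteq> 0 \<longrightarrow> g (x * y) = g x * g y"
    and form: "\<And>A. invertible A \<Longrightarrow> \<psi> A = g (det A) *\<^sub>R conjm T A"
  shows "g \<in> Mr1 CARD('n)"
  unfolding Mr1_iff
proof (intro conjI allI impI)
  fix x :: real assume x: "x \<noteq> 0" "g x ^ CARD('n) * x = 1"
  then have gx: "g x \<noteq> 0" using g by blast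
  let ?A = "inverse (g x) *\<^sub>R mat 1 :: real^'n^'n"
  have inv: "invertible ?A" using gx by (intro invertible_scaleR invertible_mat_1) auto
  have "det ?A = x" using x gx by (simp add: det_scaleR power_inverse field_simps)
  then have "\<psi> ?A = mat 1" using form[OF inv] T gx by (simp add: conjm_scaleR)
  then have "?A = mat 1" using inj[OF inv invertible_mat_1] by simp
  then have "det ?A = 1" by simp
  then show "x = 1" using \<open>det ?A = x\<close> by simp
next
  fix y :: real assume y: "y \<noteq> 0"
  fix p :: 'n
  have "det (diagm (\<lambda>k. if k = p then y else 1) :: real^'n^'n) = y" by (simp add: det_diagm)
  then obtain B :: "real^'n^'n" where B: "det B = y" by blast
  then have "invertible B" using y by (simp add: invertible_det_nz)
  then obtain A where A: "invertible A" "\<psi> A = B" using surj by blast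
  have "g (det A) ^ CARD('n) * det A = y" using A form[of A] B T by (auto simp: det_scaleR)
  then show "\<exists>x. x \<noteq> 0 \<and> g x ^ CARD('n) * x = y" using A(1) by (auto simp: invertible_det_nz)
qed (use g in \<open>simp add: hom_Rstar_iff\<close>)

lemma (in gl_aut) automorphism_form:
  assumes n: "CARD('n) \<ge> 3"
  shows "\<exists>T g. invertible T \<and> g \<in> Mr1 CARD('n) \<and>
    ((\<forall>A. invertible A \<longrightarrow> \<psi> A = g (det A) *\<^sub>R conjm T A) \<or>
     (\<forall>A. invertible A \<longrightarrow> contragr (\<psi> A) = g (det A) *\<^sub>R conjm T A))"
proof -
  interpret C: gl_aut "\<lambda>A. contragr (\<psi> A)" using gl_aut_contragr .
  obtain T g where T: "invertible T" and g: "\<forall>x. x \<noteq> 0 \<longrightarrow> g x \<noteq> 0"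
      "\<forall>x y. x \<noteq> 0 \<longrightarrow> y \<noteq> 0 \<longrightarrow> g (x * y) = g x * g y"
    and form: "(\<forall>A. invertible A \<longrightarrow> \<psi> A = g (det A) *\<^sub>R conjm T A) \<or>
      (\<forall>A. invertible A \<longrightarrow> contragr (\<psi> A) = g (det A) *\<^sub>R conjm T A)"
    using form_up_to_contragr[OF n] by (elim exE conjE) (rule that)
  have "g \<in> Mr1 CARD('n)"
    using form
  proof
    assume "\<forall>A. invertible A \<longrightarrow> \<psi> A = g (det A) *\<^sub>R conjm T A"
    then show ?thesis by (intro twist_in_Mr1[OF T g]) simp
  next
    assume "\<forall>A. invertible A \<longrightarrow> contragr (\<psi> A) = g (det A) *\<^sub>R conjm T A"
    then show ?thesis by (intro C.twist_in_Mr1[OF T g]) simp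
  qed
  then show ?thesis using T form by (intro exI[of _ T] exI[of _ g] conjI)
qed

section \<open>Rigid matrices\<close>

text \<open>The quotient tr(A^2) / tr(A)^2 is unchanged by similarity and by scaling. The inequality
  says, in cross-multiplied form, that this invariant tells A from its inverse; the nonzero trace
  makes the factor in a similarity with a multiple unique.\<close>

definition rigid :: "real^'n^'n \<Rightarrow> bool" where
  "rigid A \<longleftrightarrow> invertible A \<and> trace A \<noteq> 0 \<and>
    trace (A ** A) * (trace (matrix_inv A))\<^sup>2 \<noteq> (trace A)\<^sup>2 * trace (matrix_inv A ** matrix_inv A)"

text \<open>Compare the traces of both sides and of their squares; the scalars cancel after
  cross-multiplication.\<close>

lemma rigid_not_similar_contragr:
  fixes A :: "real^'n^'n"
  assumes A: "rigid A" and c: "c \<noteq> 0" and d: "d \<noteq> 0" and S: "invertible S" and T: "invertible T"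
    and eq: "c *\<^sub>R conjm S A = d *\<^sub>R conjm T (contragr A)"
  shows False
proof -
  have inv: "invertible A" using A by (simp add: rigid_def)
  have 1: "c * trace A = d * trace (matrix_inv A)"
    using arg_cong[OF eq, of trace] S T by (simp add: trace_scaleR trace_contragr)
  have "(c *\<^sub>R conjm S A) ** (c *\<^sub>R conjm S A) = (d *\<^sub>R conjm T (contragr A)) ** (d *\<^sub>R conjm T (contragr A))"
    using eq by simp
  then have "(c * c) *\<^sub>R conjm S (A ** A) = (d * d) *\<^sub>R conjm T (contragr (A ** A))"
    using S T inv by (simp add: scaleR_mult_left scaleR_mult_right conjm_mult contragr_mult)
  then have "(c * c) * trace (A ** A) = (d * d) * trace (matrix_inv A ** matrix_inv A)"
    using S T inv by (metis trace_scaleR trace_conjm trace_contragr matrix_inv_mult)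
  then have "(c * c) * trace (A ** A) * (d * trace (matrix_inv A))\<^sup>2 =
      (d * d) * trace (matrix_inv A ** matrix_inv A) * (c * trace A)\<^sup>2"
    using 1 by simp
  then have "(c * c * d * d) * (trace (A ** A) * (trace (matrix_inv A))\<^sup>2) =
      (c * c * d * d) * ((trace A)\<^sup>2 * trace (matrix_inv A ** matrix_inv A))"
    by (simp add: power_mult_distrib power2_eq_square mult_ac)
  then show False using A c d by (simp add: rigid_def)
qed

lemma rigid_conjm:
  assumes A: "rigid A" and T: "invertible T" shows "rigid (conjm T A)"
  using assms by (simp add: rigid_def conjm_matrix_inv flip: conjm_mult)

lemma rigid_scaleR:
  fixes A :: "real^'n^'n"
  assumes "rigid A" "c \<noteq> 0" shows "rigid (c *\<^sub>R A)"
proof -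
  have inv: "invertible A" using assms by (simp add: rigid_def)
  have e: "c * (c * x) * (inverse c * y)\<^sup>2 = x * y\<^sup>2" "(c * x)\<^sup>2 * (inverse c * (inverse c * y)) = x\<^sup>2 * y" for x y
    using assms(2) by (simp_all add: power2_eq_square field_simps)
  show ?thesis
    using assms inv by (simp add: rigid_def invertible_scaleR matrix_inv_scaleR scaleR_mult_left
      scaleR_mult_right trace_scaleR e del: scaleR_scaleR)
qed

section \<open>Explicit rigid matrices\<close>

lemma sum_one_exception:
  "(\<Sum>m\<in>UNIV. if m = k then u else v) = u + (real CARD('n) - 1) * v" for k :: "'n::finite" and u v :: real
proof -
  have "(\<Sum>m\<in>UNIV. if m = k then u else v) = (\<Sum>m\<in>UNIV. (if m = k then u - v else 0) + v)"
    by (rule sum.cong) auto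
  then show ?thesis by (simp add: sum.distrib algebra_simps)
qed

text \<open>\<open>c\<close> times a diagonal matrix with single exceptional entry \<open>a\<close>.
  Two parameters allow a prescribed determinant c^n a while \<open>a\<close> stays large enough for
  rigidity.\<close>

definition refl_diag :: "real \<Rightarrow> real \<Rightarrow> 'n \<Rightarrow> real^'n^'n" where
  "refl_diag c a k = diagm (\<lambda>m. if m = k then c * a else c)"

text \<open>
  With \<open>m = n - 1\<close>, the two sides of the rigidity condition differ by the factor
  \<open>m (m - 1) (a - 1)\<^sup>3 (a + 1)\<close>.
\<close>

lemma rigid_refl_diag:
  assumes n: "CARD('n) \<ge> 3" and c: "c \<noteq> 0" and a: "\<bar>a\<bar> > real CARD('n)"
  shows "rigid (refl_diag c a (k::'n::finite))"
proof -
  define m where "m = real CARD('n) - 1"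
  have m: "m \<ge> 2" using n by (simp add: m_def)
  \<comment> \<open>The bound on \<open>a\<close> avoids the zero of the trace and those of the
    factorisation below.\<close>
  have a': "a \<noteq> 0" "a \<noteq> 1" "a \<noteq> -1" "a + m \<noteq> 0" using a m by (auto simp: m_def)
  let ?D = "diagm (\<lambda>l. if l = k then a else 1) :: real^'n^'n"
  have inv: "invertible ?D" using a' by (simp add: invertible_diagm)
  have inv_eq: "matrix_inv ?D = diagm (\<lambda>l. if l = k then 1 / a else 1)"
    using a' by (subst matrix_inv_diagm) (auto simp: vec_eq_iff divide_inverse)
  have t1: "trace ?D = a + m" by (simp add: trace_diagm sum_one_exception m_def)
  have t2: "trace (?D ** ?D) = a * a + m"
    using sum_one_exception[of k "a * a" 1]
    by (simp add: diagm_mult trace_diagm m_def if_distrib[of "\<lambda>x. x * _"] cong: if_cong)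
  have t3: "trace (matrix_inv ?D) = 1 / a + m"
    unfolding inv_eq by (simp add: trace_diagm sum_one_exception m_def)
  have t4: "trace (matrix_inv ?D ** matrix_inv ?D) = 1 / a * (1 / a) + m"
    using sum_one_exception[of k "1 / a * (1 / a)" 1]
    unfolding inv_eq by (simp add: diagm_mult trace_diagm m_def if_distrib[of "\<lambda>x. x * _"] cong: if_cong)
  have "a\<^sup>2 * ((a * a + m) * (1 / a + m)\<^sup>2 - (a + m)\<^sup>2 * (1 / a * (1 / a) + m)) = m * (m - 1) * (a - 1) ^ 3 * (a + 1)"
    using a'(1) by (simp add: field_simps power2_eq_square power3_eq_cube)
  then have "(a * a + m) * (1 / a + m)\<^sup>2 \<noteq> (a + m)\<^sup>2 * (1 / a * (1 / a) + m)"
    using a' m by auto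
  then have "rigid ?D" using a' inv unfolding rigid_def t1 t2 t3 t4 by simp
  moreover have "refl_diag c a k = c *\<^sub>R ?D" by (auto simp: refl_diag_def vec_eq_iff)
  ultimately show ?thesis using rigid_scaleR c by metis
qed

lemma det_refl_diag: "det (refl_diag c a (k::'n::finite)) = c ^ CARD('n) * a"
proof -
  have "refl_diag c a k = c *\<^sub>R diagm (\<lambda>l. if l = k then a else 1)" by (auto simp: refl_diag_def vec_eq_iff)
  then show ?thesis by (simp add: det_scaleR det_diagm)
qed

lemma refl_diag_parameters:
  assumes n: "n \<ge> 1" and t: "t \<noteq> (0::real)"
  shows "\<exists>c a. c \<noteq> 0 \<and> \<bar>a\<bar> > real n \<and> c ^ n * a = t"
proof -
  \<comment> \<open>With c \<le> 1 one has c^n \<le> c \<le> |t| / (2n), so a = t / c^n has absolute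
    value at least 2n.\<close>
  define c where "c = min 1 (\<bar>t\<bar> / (2 * real n))"
  have c: "c > 0" "c \<le> 1" "c * (2 * real n) \<le> \<bar>t\<bar>"
    using n t by (auto simp: c_def min_def field_simps)
  have "c ^ n \<le> c ^ 1" using c n by (intro power_decreasing) auto
  then have "c ^ n * (2 * real n) \<le> \<bar>t\<bar>"
    using c(3) mult_right_mono[of "c ^ n" c "2 * real n"] by simp
  then have "2 * real n \<le> \<bar>t / c ^ n\<bar>" using c by (simp add: abs_divide field_simps)
  then have "\<bar>t / c ^ n\<bar> > real n" using n by simp
  then show ?thesis using c by (intro exI[of _ c] exI[of _ "t / c ^ n"]) auto
qed

text \<open>Distinct positive integers are placed everywhere except at \<open>p\<close>, where the
  entry 1/x is very large. As x tends to 0 from the right, the rescaled rigidity difference tends to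
  q1^2 - q2, which is positive because q1 has at least two positive terms.\<close>

lemma ex_rigid_distinct_diag:
  assumes n: "CARD('n) \<ge> 3"
  shows "\<exists>d :: 'n::finite \<Rightarrow> real. inj d \<and> (\<forall>k. d k \<noteq> 0) \<and> rigid (diagm d :: real^'n^'n)"
proof -
  obtain e :: "'n \<Rightarrow> nat" where e: "inj e" using finite_imp_inj_to_nat_seg[of "UNIV :: 'n set"] by auto
  obtain p :: 'n where True by blast
  define b where "b = (\<lambda>k. real (e k) + 1)"
  have b: "b k > 0" for k by (simp add: b_def)
  have b_inj: "b k = b l \<longleftrightarrow> k = l" for k l using e by (simp add: b_def inj_eq)
  let ?I = "UNIV - {p}"
  define s1 s2 q1 q2 where "s1 = sum b ?I" "s2 = (\<Sum>k\<in>?I. b k * b k)"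
    "q1 = (\<Sum>k\<in>?I. 1 / b k)" "q2 = (\<Sum>k\<in>?I. 1 / b k * (1 / b k))"
  have pos: "s1 \<ge> 0" "s2 \<ge> 0" "q1 \<ge> 0" "q2 \<ge> 0"
    unfolding s1_s2_q1_q2_def using b by (auto intro!: sum_nonneg simp: less_imp_le)
  have "q1\<^sup>2 > q2"
  proof -
    obtain u where u: "u \<noteq> p" using ex_third[OF n] by blast
    have le: "1 / b k < q1" if k: "k \<noteq> p" for k
    proof -
      obtain l where l: "l \<noteq> p" "l \<noteq> k" using ex_third[OF n] by blast
      have "1 / b k + 1 / b l = (\<Sum>i\<in>{k, l}. 1 / b i)" using l by simp
      also have "\<dots> \<le> q1" unfolding s1_s2_q1_q2_def
        by (rule sum_mono2) (use k l b in \<open>auto intro: less_imp_le\<close>)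
      finally show ?thesis using b[of l] by (smt (verit) zero_less_divide_1_iff)
    qed
    have "q2 < (\<Sum>k\<in>?I. 1 / b k * q1)"
      unfolding s1_s2_q1_q2_def(4)
    proof (rule sum_strict_mono)
      show "?I \<noteq> {}" using u by blast
      fix k assume "k \<in> ?I"
      then show "1 / b k * (1 / b k) < 1 / b k * q1"
        using le[of k] b[of k] by (intro mult_strict_left_mono) auto
    qed simp
    also have "\<dots> = (\<Sum>k\<in>?I. 1 / b k) * q1" by (rule sum_distrib_right[symmetric])
    also have "\<dots> = q1\<^sup>2" by (simp add: s1_s2_q1_q2_def(3) power2_eq_square)
    finally show ?thesis .
  qed
  \<comment> \<open>x^2 times the difference of the two sides in the rigidity condition, extended
    continuously to x = 0.\<close>
  define h where "h = (\<lambda>x::real. (1 + s2 * x\<^sup>2) * (x + q1)\<^sup>2 - (1 + s1 * x)\<^sup>2 * (x\<^sup>2 + q2))"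
  have "(h \<longlongrightarrow> h 0) (at_right 0)"
    unfolding h_def by (intro tendsto_intros)
  moreover have "h 0 > 0" using \<open>q1\<^sup>2 > q2\<close> by (simp add: h_def)
  ultimately have "\<forall>\<^sub>F x in at_right 0. h x > 0" by (rule order_tendstoD(1))
  moreover define B where "B = Max (range b)"
  have B: "b k \<le> B" for k by (simp add: B_def)
  then have "B > 0" using b[of p] by (meson less_le_trans)
  then have "\<forall>\<^sub>F x in at_right 0. x < 1 / B"
    by (intro eventually_at_rightI[of 0 "1 / B"]) auto
  moreover have "\<forall>\<^sub>F x in at_right (0::real). 0 < x" by (simp add: eventually_at_right_less)
  ultimately have "\<forall>\<^sub>F x in at_right 0. h x > 0 \<and> x < 1 / B \<and> 0 < x"
    by eventually_elim auto
  then obtain x where x: "h x > 0" "x < 1 / B" "0 < x"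
    using eventually_happens'[OF trivial_limit_at_right_real] by blast
  define d where "d = (\<lambda>k. if k = p then 1 / x else b k)"
  \<comment> \<open>The exceptional entry exceeds all others, which keeps the entries
    distinct.\<close>
  have "1 / x > B" using x \<open>B > 0\<close> by (simp add: field_simps)
  then have bx: "b k \<noteq> 1 / x" for k using B[of k] by simp
  have "inj d"
  proof (rule injI)
    fix k l assume "d k = d l"
    then show "k = l" using bx[of k] bx[of l] by (auto simp: d_def b_inj split: if_splits)
  qed
  have d: "d k \<noteq> 0" for k using x b[of k] by (auto simp: d_def)
  have split: "(\<Sum>k\<in>UNIV. f k) = f p + sum f ?I" for f :: "'n \<Rightarrow> real"
    by (simp add: sum.remove)
  have t1: "trace (diagm d :: real^'n^'n) = 1 / x + s1"
    by (simp add: trace_diagm split s1_s2_q1_q2_def d_def)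
  have t2: "trace (diagm d ** diagm d :: real^'n^'n) = 1 / x * (1 / x) + s2"
    by (simp add: diagm_mult trace_diagm split s1_s2_q1_q2_def d_def)
  have t3: "trace (matrix_inv (diagm d :: real^'n^'n)) = x + q1"
    using d by (simp add: matrix_inv_diagm trace_diagm split s1_s2_q1_q2_def)
      (simp add: d_def divide_inverse)
  have t4: "trace (matrix_inv (diagm d) ** matrix_inv (diagm d) :: real^'n^'n) = x\<^sup>2 + q2"
    using d by (simp add: matrix_inv_diagm diagm_mult trace_diagm split s1_s2_q1_q2_def)
      (simp add: d_def divide_inverse power2_eq_square)
  have "x\<^sup>2 * ((1 / x * (1 / x) + s2) * (x + q1)\<^sup>2 - (1 / x + s1)\<^sup>2 * (x\<^sup>2 + q2)) = h x"
    using x unfolding h_def by (simp add: field_simps power2_eq_square)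
  then have "(1 / x * (1 / x) + s2) * (x + q1)\<^sup>2 \<noteq> (1 / x + s1)\<^sup>2 * (x\<^sup>2 + q2)"
    using x(1) by auto
  moreover have "1 / x + s1 > 0" using x pos by (simp add: add_pos_nonneg)
  ultimately have "rigid (diagm d :: real^'n^'n)"
    using d unfolding rigid_def t1 t2 t3 t4 by (simp add: invertible_diagm)
  then show ?thesis using \<open>inj d\<close> d by blast
qed

section \<open>Local automorphisms\<close>

lemma trace_mult_diagm: "trace (M ** diagm d) = (\<Sum>k\<in>UNIV. M $ k $ k * d k)"
  by (simp add: trace_def)

text \<open>Such a conjugate differs from the diagonal matrix in one off-diagonal entry. Together
  with \<open>trace_mult_unit\<close> it serves to isolate a single matrix entry inside a
  trace.\<close>

lemma conjm_transv_diagm: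
  assumes "i \<noteq> j"
  shows "conjm (transv i j 1) (diagm d) = diagm d + (\<chi> k l. if k = i \<and> l = j then d j - d i else 0)"
  using assms by (simp add: conjm_eq_iff invertible_transv)
    (auto simp: vec_eq_iff mult_transv_nth transv_nth)

lemma trace_mult_unit:
  "trace (M ** (\<chi> k l. if k = i \<and> l = j then b else 0)) = M $ j $ i * b" for M :: "real^'n^'n"
proof -
  have "trace (M ** (\<chi> k l. if k = i \<and> l = j then b else 0)) =
      (\<Sum>k\<in>UNIV. \<Sum>m\<in>UNIV. if m = i then (if k = j then M $ k $ m * b else 0) else 0)"
    unfolding trace_def mult_nth by (intro sum.cong refl) auto
  then show ?thesis by simp
qed

lemma conjm_diagm_diagm: "(\<And>k. e k \<noteq> 0) \<Longrightarrow> conjm (diagm e) (diagm d) = diagm d"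
  by (simp add: conjm_eq_iff invertible_diagm diagm_mult mult.commute)

text \<open>A local automorphism normalised at a rigid diagonal matrix. \<open>pair\<close> is the
  local hypothesis after the classification of automorphisms; the inverted scalar in its second
  alternative arises from applying the contragredient map to the formula for the contragredient of
  the image.\<close>

locale normalized_local_aut =
  fixes \<phi> :: "real^'n^'n \<Rightarrow> real^'n^'n" and d0 :: "'n \<Rightarrow> real" and c0 :: real
  assumes n: "CARD('n) \<ge> 3"
    and pair: "invertible A \<Longrightarrow> invertible B \<Longrightarrow> \<exists>T g. invertible T \<and> g \<in> Mr1 CARD('n) \<and>
      (\<phi> A = g (det A) *\<^sub>R conjm T A \<and> \<phi> B = g (det B) *\<^sub>R conjm T B \<or>
       \<phi> A = inverse (g (det A)) *\<^sub>R conjm T (contragr A) \<and>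
       \<phi> B = inverse (g (det B)) *\<^sub>R conjm T (contragr B))"
    and d0: "inj d0" "rigid (diagm d0 :: real^'n^'n)"
    and c0: "c0 \<noteq> 0" "\<phi> (diagm d0) = c0 *\<^sub>R diagm d0"
begin

lemma rigid_invertible: "rigid A \<Longrightarrow> invertible A"
  by (simp add: rigid_def)

lemma det_nonzero: "invertible A \<Longrightarrow> det A \<noteq> 0" for A :: "real^'n^'n"
  by (simp add: invertible_det_nz)

text \<open>Pair \<open>X\<close> with the base matrix. Rigidity of the base excludes the
  contragredient alternative and its trace identifies the scalar with \<open>c0\<close>; then
  \<open>T\<close> commutes with a diagonal matrix with distinct entries and is itself
  diagonal.\<close>

lemma image_diagonally_similar:
  assumes X: "invertible X"
  shows "\<exists>c d. c \<noteq> 0 \<and> (\<forall>k. d k \<noteq> 0) \<and> \<phi> X = c *\<^sub>R conjm (diagm d) X"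
proof -
  let ?D = "diagm d0 :: real^'n^'n"
  have D: "invertible ?D" using d0(2) by (rule rigid_invertible)
  obtain T g where T: "invertible T" "g \<in> Mr1 CARD('n)" and
    alt: "\<phi> ?D = g (det ?D) *\<^sub>R conjm T ?D \<and> \<phi> X = g (det X) *\<^sub>R conjm T X \<or>
      \<phi> ?D = inverse (g (det ?D)) *\<^sub>R conjm T (contragr ?D) \<and>
      \<phi> X = inverse (g (det X)) *\<^sub>R conjm T (contragr X)"
    using pair[OF D X] by blast
  have g: "g (det ?D) \<noteq> 0" "g (det X) \<noteq> 0"
    using Mr1_D(1)[OF T(2)] det_nonzero D X by blast+
  from alt have eq: "c0 *\<^sub>R ?D = g (det ?D) *\<^sub>R conjm T ?D" and \<phi>X: "\<phi> X = g (det X) *\<^sub>R conjm T X"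
  proof (atomize(full), elim disjE)
    assume "\<phi> ?D = inverse (g (det ?D)) *\<^sub>R conjm T (contragr ?D) \<and>
      \<phi> X = inverse (g (det X)) *\<^sub>R conjm T (contragr X)"
    then have "c0 *\<^sub>R conjm (mat 1) ?D = inverse (g (det ?D)) *\<^sub>R conjm T (contragr ?D)"
      using c0(2) by simp
    from rigid_not_similar_contragr[OF d0(2) c0(1) _ invertible_mat_1 T(1) this] g(1)
    show "c0 *\<^sub>R ?D = g (det ?D) *\<^sub>R conjm T ?D \<and> \<phi> X = g (det X) *\<^sub>R conjm T X" by simp
  qed (use c0(2) in simp)
  have "c0 = g (det ?D)"
    using arg_cong[OF eq, of trace] T(1) d0(2) by (simp add: trace_scaleR rigid_def)
  then have "conjm T ?D = ?D" using eq c0(1) by simp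
  then have comm: "T ** ?D = ?D ** T" using T(1) by (simp add: conjm_eq_iff)
  have "T $ k $ l = 0" if "k \<noteq> l" for k l
  proof -
    have "(T ** ?D) $ k $ l = (?D ** T) $ k $ l" using comm by simp
    moreover have "d0 k \<noteq> d0 l" using d0(1) that by (simp add: inj_eq)
    ultimately show ?thesis by simp
  qed
  then have "T = diagm (\<lambda>k. T $ k $ k)" by (auto simp: vec_eq_iff)
  then obtain d where "T = diagm d" by blast
  then show ?thesis using \<phi>X g(2) T(1) by (auto simp: invertible_diagm)
qed

text \<open>The image of \<open>X\<close> is already known to be a multiple of a conjugate of
  \<open>X\<close>, so rigidity excludes the contragredient alternative for the whole pair.\<close>

lemma pair_rigid:
  assumes X: "rigid X" and Z: "invertible Z"
  shows "\<exists>T g. invertible T \<and> g \<in> Mr1 CARD('n) \<and>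
    \<phi> X = g (det X) *\<^sub>R conjm T X \<and> \<phi> Z = g (det Z) *\<^sub>R conjm T Z"
proof -
  have iX: "invertible X" using X by (rule rigid_invertible)
  obtain T g where T: "invertible T" "g \<in> Mr1 CARD('n)" and
    alt: "\<phi> X = g (det X) *\<^sub>R conjm T X \<and> \<phi> Z = g (det Z) *\<^sub>R conjm T Z \<or>
      \<phi> X = inverse (g (det X)) *\<^sub>R conjm T (contragr X) \<and>
      \<phi> Z = inverse (g (det Z)) *\<^sub>R conjm T (contragr Z)"
    using pair[OF iX Z] by blast
  have g: "inverse (g (det X)) \<noteq> 0" using Mr1_D(1)[OF T(2)] det_nonzero[OF iX] by simp
  obtain c d where c: "c \<noteq> 0" "\<And>k. d k \<noteq> 0" "\<phi> X = c *\<^sub>R conjm (diagm d) X"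
    using image_diagonally_similar[OF iX] by blast
  have D: "invertible (diagm d :: real^'n^'n)" using c(2) by (simp add: invertible_diagm)
  have "\<phi> X \<noteq> inverse (g (det X)) *\<^sub>R conjm T (contragr X)"
    using rigid_not_similar_contragr[OF X c(1) g D T(1)] c(3) by auto
  then show ?thesis using alt T by blast
qed

text \<open>One choice of (c, a) for each determinant \<open>t\<close>, shared by the test matrices
  \<open>\<rho> t k\<close> at all positions \<open>k\<close>.\<close>

definition params :: "real \<Rightarrow> real \<times> real" where
  "params t = (SOME p. fst p \<noteq> 0 \<and> \<bar>snd p\<bar> > real CARD('n) \<and> fst p ^ CARD('n) * snd p = t)"

definition \<rho> :: "real \<Rightarrow> 'n \<Rightarrow> real^'n^'n" where
  "\<rho> t k = refl_diag (fst (params t)) (snd (params t)) k"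

lemma \<rho>_params:
  assumes "t \<noteq> 0"
  obtains c a where "c \<noteq> 0" "\<bar>a\<bar> > real CARD('n)" "c ^ CARD('n) * a = t" "\<And>k. \<rho> t k = refl_diag c a k"
proof -
  obtain c a where "c \<noteq> 0" "\<bar>a\<bar> > real CARD('n)" "c ^ CARD('n) * a = t"
    using refl_diag_parameters[of "CARD('n)" t] n assms by auto
  then have "\<exists>p. fst p \<noteq> 0 \<and> \<bar>snd p\<bar> > real CARD('n) \<and> fst p ^ CARD('n) * snd p = t"
    by (intro exI[of _ "(c, a)"]) simp
  from someI_ex[OF this] show ?thesis
    unfolding params_def[symmetric] by (intro that[of "fst (params t)" "snd (params t)"]) (auto simp: \<rho>_def)
qed

lemma rigid_\<rho>: "t \<noteq> 0 \<Longrightarrow> rigid (\<rho> t k)"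
  by (erule \<rho>_params[of t]) (simp add: rigid_refl_diag n)

lemma det_\<rho>: "t \<noteq> 0 \<Longrightarrow> det (\<rho> t k) = t"
  by (erule \<rho>_params[of t]) (simp add: det_refl_diag)

text \<open>The scalar by which \<open>\<phi>\<close> acts at determinant \<open>t\<close>, read off
  from one rigid matrix, whose trace is nonzero; \<open>undefined\<close> is just some fixed
  index.\<close>

definition f :: "real \<Rightarrow> real" where
  "f t = trace (\<phi> (\<rho> t undefined)) / trace (\<rho> t undefined)"

lemma f_eq:
  assumes t: "t \<noteq> 0" and T: "invertible T" and "\<phi> (\<rho> t undefined) = c *\<^sub>R conjm T (\<rho> t undefined)"
  shows "f t = c"
  using assms rigid_\<rho>[OF t, of undefined] by (simp add: f_def trace_scaleR rigid_def)

lemma f_nonzero: "t \<noteq> 0 \<Longrightarrow> f t \<noteq> 0"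
  using image_diagonally_similar[of "\<rho> t undefined"] rigid_\<rho>[of t undefined] f_eq
  by (metis invertible_diagm rigid_invertible)

text \<open>Pairing the test matrices of determinants \<open>t\<close> and \<open>s\<close> yields
  one \<open>g\<close> that gives both scalars.\<close>

lemma f_LMr1: "f \<in> LMr1 CARD('n)"
proof -
  have "\<exists>g\<in>Mr1 CARD('n). f t = g t \<and> f s = g s" if ts: "t \<noteq> 0" "s \<noteq> 0" for t s
  proof -
    obtain T g where T: "invertible T" "g \<in> Mr1 CARD('n)"
      "\<phi> (\<rho> t undefined) = g (det (\<rho> t undefined)) *\<^sub>R conjm T (\<rho> t undefined)"
      "\<phi> (\<rho> s undefined) = g (det (\<rho> s undefined)) *\<^sub>R conjm T (\<rho> s undefined)"
      using pair_rigid[OF rigid_\<rho>[OF ts(1)] rigid_invertible[OF rigid_\<rho>[OF ts(2)]], of undefined undefined]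
      by blast
    then show ?thesis using f_eq[OF ts(1) T(1,3)] f_eq[OF ts(2) T(1,4)] ts by (auto simp: det_\<rho>)
  qed
  then show ?thesis using f_nonzero by (auto simp: LMr1_def locally_in_def Rstar_def)
qed

text \<open>Pair \<open>X\<close> with the test matrix of the same determinant: both receive the
  same scalar, and the nonzero traces determine it.\<close>

lemma rigid_factor:
  assumes X: "rigid X" and T: "invertible T" and eq: "\<phi> X = c *\<^sub>R conjm T X"
  shows "c = f (det X)"
proof -
  have t: "det X \<noteq> 0" using X rigid_invertible det_nonzero by blast
  obtain S g where S: "invertible S" "g \<in> Mr1 CARD('n)" "\<phi> X = g (det X) *\<^sub>R conjm S X"
      "\<phi> (\<rho> (det X) undefined) = g (det X) *\<^sub>R conjm S (\<rho> (det X) undefined)"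
    using pair_rigid[OF X, of "\<rho> (det X) undefined"] rigid_\<rho> det_\<rho> t rigid_invertible by metis
  have "c * trace X = g (det X) * trace X"
    using arg_cong[OF S(3), of trace] T S(1) eq by (simp add: trace_scaleR)
  then have "c = g (det X)" using X by (simp add: rigid_def)
  then show ?thesis using f_eq[OF t S(1,4)] by simp
qed

text \<open>The expected scalar is divided out. For rigid \<open>Z\<close> this leaves a conjugate
  of \<open>Z\<close>; otherwise, at this stage, only a multiple of one.\<close>

definition N :: "real^'n^'n \<Rightarrow> real^'n^'n" where
  "N Z = inverse (f (det Z)) *\<^sub>R \<phi> Z"

lemma \<phi>_eq_N: "invertible Z \<Longrightarrow> \<phi> Z = f (det Z) *\<^sub>R N Z"
  by (simp add: N_def f_nonzero det_nonzero)

lemma N_similar: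
  assumes "invertible Z"
  shows "\<exists>c d. c \<noteq> 0 \<and> (\<forall>k. d k \<noteq> 0) \<and> N Z = c *\<^sub>R conjm (diagm d) Z"
proof -
  obtain c d where c: "c \<noteq> 0" "\<forall>k. d k \<noteq> 0" "\<phi> Z = c *\<^sub>R conjm (diagm d) Z"
    using image_diagonally_similar[OF assms] by blast
  then show ?thesis using f_nonzero det_nonzero[OF assms]
    by (intro exI[of _ "inverse (f (det Z)) * c"] exI[of _ d]) (auto simp: N_def)
qed

lemma N_rigid:
  assumes X: "rigid X"
  shows "\<exists>d. (\<forall>k. d k \<noteq> 0) \<and> N X = conjm (diagm d) X"
proof -
  obtain c d where c: "c \<noteq> 0" "\<forall>k. d k \<noteq> 0" "\<phi> X = c *\<^sub>R conjm (diagm d) X"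
    using image_diagonally_similar[OF rigid_invertible[OF X]] by blast
  then have "c = f (det X)" using rigid_factor[OF X _ c(3)] by (simp add: invertible_diagm)
  then show ?thesis using c by (intro exI[of _ d]) (simp add: N_def)
qed

text \<open>Both images come from the same \<open>T\<close> and \<open>g\<close>. The scalar at
  \<open>Z\<close> is the expected one either because \<open>Z\<close> is rigid or because
  \<open>g\<close> is evaluated at the determinant of \<open>X\<close>, so the trace of the product
  is preserved.\<close>

lemma trace_N_mult:
  assumes X: "rigid X" and Z: "invertible Z" "rigid Z \<or> det Z = det X"
  shows "trace (N Z ** N X) = trace (Z ** X)"
proof -
  obtain T g where T: "invertible T" "g \<in> Mr1 CARD('n)"
      "\<phi> X = g (det X) *\<^sub>R conjm T X" "\<phi> Z = g (det Z) *\<^sub>R conjm T Z"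
    using pair_rigid[OF X Z(1)] by blast
  have "g (det X) = f (det X)" using rigid_factor[OF X T(1,3)] .
  moreover have "g (det Z) = f (det Z)"
    using Z(2) rigid_factor[of Z, OF _ T(1,4)] rigid_factor[OF X T(1,3)] by auto
  ultimately have "N X = conjm T X" "N Z = conjm T Z"
    using T f_nonzero det_nonzero Z(1) rigid_invertible[OF X] by (auto simp: N_def)
  then show ?thesis using T(1) by (simp flip: conjm_mult)
qed

lemma N_\<rho>:
  assumes t: "t \<noteq> 0" shows "N (\<rho> t k) = \<rho> t k"
proof -
  obtain d where d: "\<And>k. d k \<noteq> 0" "N (\<rho> t k) = conjm (diagm d) (\<rho> t k)"
    using N_rigid[OF rigid_\<rho>[OF t, of k]] by blast
  obtain c a where r: "\<rho> t k = refl_diag c a k" using \<rho>_params[OF t] by metis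
  show ?thesis unfolding d(2) unfolding r refl_diag_def by (rule conjm_diagm_diagm) (rule d(1))
qed

lemma trace_N_\<rho>:
  assumes "t \<noteq> 0" "invertible Z" "rigid Z \<or> det Z = t"
  shows "trace (N Z ** \<rho> t k) = trace (Z ** \<rho> t k)"
  using trace_N_mult[OF rigid_\<rho>[OF assms(1)], of Z k] assms by (simp add: N_\<rho> det_\<rho>)

text \<open>Traces against the test matrices at all positions give a linear system for the
  differences \<open>y\<close> of the diagonal entries, with matrix J + (a - 1) I, where J is the
  all-ones matrix.\<close>

lemma N_diagonal:
  assumes Z: "invertible Z" shows "N Z $ k $ k = Z $ k $ k"
proof -
  define t where "t = det Z"
  have t: "t \<noteq> 0" using det_nonzero[OF Z] by (simp add: t_def)
  obtain c a where c: "c \<noteq> 0" "\<bar>a\<bar> > real CARD('n)" "\<And>k. \<rho> t k = refl_diag c a k"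
    using \<rho>_params[OF t] by metis
  define y where "y = (\<lambda>k. N Z $ k $ k - Z $ k $ k)"
  have tr: "trace (M ** \<rho> t k) = c * ((\<Sum>m\<in>UNIV. M $ m $ m) + (a - 1) * M $ k $ k)" for M :: "real^'n^'n" and k
  proof -
    have "trace (M ** \<rho> t k) = (\<Sum>m\<in>UNIV. c * M $ m $ m + (if m = k then c * (a - 1) * M $ m $ m else 0))"
      unfolding c(3) refl_diag_def trace_mult_diagm by (rule sum.cong) (auto simp: algebra_simps)
    then show ?thesis by (simp add: sum.distrib algebra_simps flip: sum_distrib_left)
  qed
  have y: "sum y UNIV + (a - 1) * y k = 0" for k
  proof -
    have "c * ((\<Sum>m\<in>UNIV. N Z $ m $ m) + (a - 1) * N Z $ k $ k) = c * ((\<Sum>m\<in>UNIV. Z $ m $ m) + (a - 1) * Z $ k $ k)"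
      using trace_N_\<rho>[OF t Z, of k] unfolding tr by (simp add: t_def)
    then have "(\<Sum>m\<in>UNIV. N Z $ m $ m) + (a - 1) * N Z $ k $ k = (\<Sum>m\<in>UNIV. Z $ m $ m) + (a - 1) * Z $ k $ k"
      using c(1) by simp
    then show ?thesis by (simp add: y_def sum_subtractf algebra_simps)
  qed
  \<comment> \<open>The two eigenvalues of the system; both are nonzero because |a| > n.\<close>
  have a: "a - 1 \<noteq> 0" "real CARD('n) + (a - 1) \<noteq> 0" using c(2) n by auto
  have const: "y l = y k" for l
  proof -
    have "(a - 1) * y l = (a - 1) * y k" using y[of l] y[of k] by linarith
    then show ?thesis using a(1) by simp
  qed
  have "sum y UNIV = real CARD('n) * y k" using const by (simp add: sum.cong[of UNIV UNIV y "\<lambda>_. y k"])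
  then have "(real CARD('n) + (a - 1)) * y k = 0" using y[of k] by (simp add: algebra_simps)
  then show ?thesis using a(2) by (simp add: y_def)
qed

text \<open>Test with a conjugate of \<open>\<rho> t i\<close> that has one extra entry at (i, j).
  Diagonal conjugation only rescales this entry, so subtracting the trace against
  \<open>\<rho> t i\<close> leaves the (j, i) entry. The factor depends on the test matrix but not
  on \<open>Z\<close>.\<close>

lemma N_off_diagonal_at:
  assumes ij: "i \<noteq> j" and t: "t \<noteq> 0"
  shows "\<exists>\<mu>. \<mu> \<noteq> 0 \<and> (\<forall>Z. invertible Z \<longrightarrow> rigid Z \<or> det Z = t \<longrightarrow> N Z $ j $ i * \<mu> = Z $ j $ i)"
proof -
  obtain c a where c: "c \<noteq> 0" "\<bar>a\<bar> > real CARD('n)" "\<rho> t i = refl_diag c a i"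
    using \<rho>_params[OF t] by metis
  \<comment> \<open>The difference of the diagonal entries of \<open>\<rho> t i\<close> at
    \<open>j\<close> and \<open>i\<close>, which is the extra entry of \<open>X\<close>.\<close>
  define \<delta> where "\<delta> = c - c * a"
  have \<delta>: "\<delta> \<noteq> 0" using c n by (auto simp: \<delta>_def)
  define E where "E = (\<lambda>b::real. \<chi> k l. if k = i \<and> l = j then b else 0 :: real^'n^'n)"
  define X where "X = conjm (transv i j 1) (\<rho> t i)"
  have X: "X = \<rho> t i + E \<delta>"
    using ij unfolding X_def c(3) refl_diag_def conjm_transv_diagm[OF ij] by (simp add: E_def \<delta>_def)
  have rX: "rigid X" unfolding X_def by (intro rigid_conjm rigid_\<rho> t invertible_transv ij)
  have dX: "det X = t" unfolding X_def by (simp add: invertible_transv ij det_\<rho> t)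
  obtain e where e: "\<And>k. e k \<noteq> 0" "N X = conjm (diagm e) X" using N_rigid[OF rX] by blast
  have NX: "N X = \<rho> t i + E (e i / e j * \<delta>)"
  proof -
    have "conjm (diagm e) X $ k $ l = (\<rho> t i + E (e i / e j * \<delta>)) $ k $ l" for k l
      using ij e(1) unfolding X by (auto simp: conjm_diagm_nth c(3) refl_diag_def E_def)
    then show ?thesis by (simp add: e(2) vec_eq_iff)
  qed
  have "N Z $ j $ i * (e i / e j) = Z $ j $ i" if Z: "invertible Z" "rigid Z \<or> det Z = t" for Z
  proof -
    have "trace (N Z ** N X) = trace (Z ** X)" using trace_N_mult[OF rX Z(1)] Z(2) dX by simp
    then have "N Z $ j $ i * (e i / e j) * \<delta> = Z $ j $ i * \<delta>"
      unfolding NX unfolding X using trace_N_\<rho>[OF t Z, of i]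
      by (simp add: matrix_add_ldistrib trace_add E_def trace_mult_unit)
    then show ?thesis using \<delta> by (simp only: mult_cancel_right) simp
  qed
  then show ?thesis using e(1) by (intro exI[of _ "e i / e j"]) simp
qed

text \<open>The factors for different determinants agree: a rigid \<open>X\<close> with nonzero (j,
  i) entry satisfies the equation for determinant 1 and for that of \<open>Z\<close>, whatever its
  own determinant is.\<close>

lemma N_off_diagonal:
  assumes ij: "i \<noteq> j"
  shows "\<exists>\<mu>. \<mu> \<noteq> 0 \<and> (\<forall>Z. invertible Z \<longrightarrow> N Z $ j $ i * \<mu> = Z $ j $ i)"
proof -
  define X where "X = conjm (transv j i 1) (\<rho> 1 j)"
  have rX: "rigid X" unfolding X_def using ij by (intro rigid_conjm rigid_\<rho> invertible_transv) auto
  have iX: "invertible X" using rX by (rule rigid_invertible)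
  have X_ji: "X $ j $ i \<noteq> 0"
  proof -
    obtain c a where c: "c \<noteq> 0" "\<bar>a\<bar> > real CARD('n)" "\<rho> 1 j = refl_diag c a j"
      using \<rho>_params[of 1] by (metis one_neq_zero)
    then show ?thesis using ij n
      unfolding X_def c(3) refl_diag_def conjm_transv_diagm[OF ij[symmetric]] by auto
  qed
  obtain \<mu> where \<mu>: "\<mu> \<noteq> 0" "\<And>Z. invertible Z \<Longrightarrow> rigid Z \<or> det Z = 1 \<Longrightarrow> N Z $ j $ i * \<mu> = Z $ j $ i"
    using N_off_diagonal_at[OF ij, of 1] by auto
  have "N Z $ j $ i * \<mu> = Z $ j $ i" if Z: "invertible Z" for Z
  proof -
    obtain \<nu> where \<nu>: "\<nu> \<noteq> 0"
      "\<And>Z'. invertible Z' \<Longrightarrow> rigid Z' \<or> det Z' = det Z \<Longrightarrow> N Z' $ j $ i * \<nu> = Z' $ j $ i"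
      using N_off_diagonal_at[OF ij det_nonzero[OF Z]] by auto
    have "N X $ j $ i * \<mu> = N X $ j $ i * \<nu>" "N X $ j $ i \<noteq> 0"
      using \<mu>(2)[OF iX] \<nu>(2)[OF iX] rX X_ji by auto
    then have "\<mu> = \<nu>" by simp
    then show ?thesis using \<nu>(2)[OF Z] by simp
  qed
  then show ?thesis using \<mu>(1) by blast
qed

text \<open>A matrix without zero entries, against which all off-diagonal factors can be measured at
  once.\<close>

lemma invertible_full_matrix: "invertible (mat 1 + (\<chi> k l. 1) :: real^'n^'n)"
proof -
  define r where "r = real CARD('n) + 1"
  have r: "r \<noteq> 0" by (simp add: r_def add_nonneg_eq_0_iff)
  define J :: "real^'n^'n" where "J = (\<chi> k l. 1)"
  have distrib: "(A + B) ** C = A ** C + B ** C" for A B C :: "real^'n^'n"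
    by (simp add: vec_eq_iff mult_nth distrib_right sum.distrib)
  have JJ: "J ** J = real CARD('n) *\<^sub>R J" by (simp add: J_def vec_eq_iff mult_nth)
  \<comment> \<open>Solves 1 + u + u n = 0, the condition for I + u J to be the inverse of I +
    J.\<close>
  define u where "u = - 1 / r"
  have u: "1 + u + u * real CARD('n) = 0" using r by (simp add: u_def r_def field_simps)
  have "(mat 1 + J) ** (mat 1 + u *\<^sub>R J) = mat 1 + (1 + u + u * real CARD('n)) *\<^sub>R J"
    by (simp add: matrix_add_ldistrib distrib scaleR_mult_right JJ scaleR_add_left scaleR_add_right)
  then have "(mat 1 + J) ** (mat 1 + u *\<^sub>R J) = mat 1" by (simp add: u)
  then have "invertible (mat 1 + J)" by (auto simp: invertible_right_inverse)
  then show ?thesis by (simp add: J_def)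
qed

text \<open>On the matrix without zero entries, \<open>N\<close> is a multiple of a diagonal
  conjugation, and the diagonal entries force the multiple to be 1. This shows that the factor at
  (j, i) is d_i / d_j, and these factors are valid for every \<open>Z\<close>.\<close>

lemma N_conjm: "\<exists>d. (\<forall>k. d k \<noteq> 0) \<and> (\<forall>Z. invertible Z \<longrightarrow> N Z = conjm (diagm d) Z)"
proof -
  let ?J = "mat 1 + (\<chi> k l. 1) :: real^'n^'n"
  have J: "?J $ k $ l \<noteq> 0" for k l by (simp add: mat_def)
  obtain c d where c: "c \<noteq> 0" "\<And>k. d k \<noteq> 0" "N ?J = c *\<^sub>R conjm (diagm d) ?J"
    using N_similar[OF invertible_full_matrix] by blast
  have "N ?J $ k $ k = c * ?J $ k $ k" for k
    using c(2) by (simp add: c(3) conjm_diagm_nth)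
  then have "c = 1" using N_diagonal[OF invertible_full_matrix] J by (metis mult_cancel_right1)
  then have NJ: "N ?J $ j $ i = d j * ?J $ j $ i / d i" for i j
    using c(2) by (simp add: c(3) conjm_diagm_nth)
  have "N Z $ j $ i = d j * Z $ j $ i / d i" if Z: "invertible Z" for Z i j
  proof (cases "i = j")
    case True
    then show ?thesis using c(2) N_diagonal[OF Z] by simp
  next
    case False
    obtain \<mu> where \<mu>: "\<mu> \<noteq> 0" "\<And>Z. invertible Z \<Longrightarrow> N Z $ j $ i * \<mu> = Z $ j $ i"
      using N_off_diagonal[OF False] by blast
    define w where "w = ?J $ j $ i"
    have "w \<noteq> 0" unfolding w_def by (rule J)
    have "d j * w / d i * \<mu> = w" using \<mu>(2)[OF invertible_full_matrix] unfolding NJ w_def .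
    then have "w * (d j * \<mu>) = w * d i" using c(2)[of i] by (simp add: field_simps)
    then have "d j * \<mu> = d i" using \<open>w \<noteq> 0\<close> by simp
    then show ?thesis using \<mu>(2)[OF Z] \<mu>(1) c(2) by (metis mult.assoc mult.commute nonzero_eq_divide_eq)
  qed
  then have "N Z = conjm (diagm d) Z" if "invertible Z" for Z
    using that c(2) by (simp add: vec_eq_iff conjm_diagm_nth)
  then show ?thesis using c(2) by blast
qed

lemma global_form:
  "\<exists>T f. invertible T \<and> f \<in> LMr1 CARD('n) \<and> (\<forall>A. invertible A \<longrightarrow> \<phi> A = f (det A) *\<^sub>R conjm T A)"
proof -
  obtain d where d: "\<And>k. d k \<noteq> 0" "\<And>Z. invertible Z \<Longrightarrow> N Z = conjm (diagm d) Z"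
    using N_conjm by blast
  then have "invertible (diagm d :: real^'n^'n)" by (simp add: invertible_diagm)
  then show ?thesis using f_LMr1 \<phi>_eq_N d(2)
    by (intro exI[of _ "diagm d"] exI[of _ f] conjI) auto
qed

end

section \<open>From the normalised case to the equivalence\<close>

lemma local_automorphism_GL_iff:
  "local_automorphism GL \<phi> \<longleftrightarrow> (\<forall>A. invertible A \<longrightarrow> invertible (\<phi> A)) \<and>
    (\<forall>A B. invertible A \<longrightarrow> invertible B \<longrightarrow> (\<exists>\<psi>. gl_aut \<psi> \<and> \<phi> A = \<psi> A \<and> \<phi> B = \<psi> B))"
  by (auto simp: local_automorphism_def gl_aut_iff_iso GL_def Pi_def Bex_def)

definition twist_form :: "(real^'n^'n \<Rightarrow> real^'n^'n) \<Rightarrow> bool" where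
  "twist_form \<phi> \<longleftrightarrow> (\<exists>T f. invertible T \<and> f \<in> LMr1 CARD('n) \<and>
    (\<forall>A. invertible A \<longrightarrow> \<phi> A = f (det A) *\<^sub>R conjm T A))"

lemma local_automorphism_contragr:
  assumes "local_automorphism GL \<phi>"
  shows "local_automorphism GL (\<lambda>A. contragr (\<phi> A))"
  using assms gl_aut.gl_aut_contragr unfolding local_automorphism_GL_iff
  by (metis invertible_contragr)

lemma local_automorphism_cong:
  assumes "local_automorphism GL \<phi>" "\<And>A. invertible A \<Longrightarrow> \<phi>' A = \<phi> A"
  shows "local_automorphism GL \<phi>'"
  using assms unfolding local_automorphism_GL_iff by metis

text \<open>For given A and B, a single \<open>g\<close> agrees with \<open>f\<close> at both
  determinants, and the twist by this \<open>g\<close> is an automorphism.\<close>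

lemma local_automorphism_twist_form:
  fixes \<phi> :: "real^'n^'n \<Rightarrow> real^'n^'n"
  assumes "twist_form \<phi>"
  shows "local_automorphism GL \<phi>"
proof -
  obtain T f where T: "invertible T" and f: "f \<in> LMr1 CARD('n)"
    and form: "\<And>A. invertible A \<Longrightarrow> \<phi> A = f (det A) *\<^sub>R conjm T A"
    using assms unfolding twist_form_def by blast
  have "\<exists>\<psi>. gl_aut \<psi> \<and> \<phi> A = \<psi> A \<and> \<phi> B = \<psi> B" if AB: "invertible A" "invertible B" for A B
  proof -
    have "\<exists>g\<in>Mr1 CARD('n). f (det A) = g (det A) \<and> f (det B) = g (det B)"
      using f AB by (simp add: LMr1_def locally_in_def Rstar_def invertible_det_nz)
    then obtain g where "g \<in> Mr1 CARD('n)" "f (det A) = g (det A)" "f (det B) = g (det B)" by blast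
    then show ?thesis
      by (intro exI[of _ "\<lambda>A. g (det A) *\<^sub>R conjm T A"]) (simp add: gl_aut_scalar_twist T form AB)
  qed
  then show ?thesis unfolding local_automorphism_GL_iff
    by (metis gl_aut.invertible_image)
qed

text \<open>Composing with conjugation by the inverse of \<open>T\<close> normalises the map at
  \<open>diagm d\<close>; the classification of automorphisms supplies \<open>pair\<close>.\<close>

lemma twist_form_of_normalized:
  fixes \<phi> :: "real^'n^'n \<Rightarrow> real^'n^'n"
  assumes n: "CARD('n) \<ge> 3" and loc: "local_automorphism GL \<phi>"
    and d: "inj d" "rigid (diagm d :: real^'n^'n)"
    and T: "invertible T" and c: "c \<noteq> 0" and base: "\<phi> (diagm d) = c *\<^sub>R conjm T (diagm d)"
  shows "twist_form \<phi>"
proof -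
  let ?S = "matrix_inv T"
  have S: "invertible ?S" using T by (rule invertible_matrix_inv)
  interpret L: normalized_local_aut "\<lambda>A. conjm ?S (\<phi> A)" d c
  proof
    fix A B :: "real^'n^'n"
    assume AB: "invertible A" "invertible B"
    obtain \<psi> where \<psi>: "gl_aut \<psi>" "\<phi> A = \<psi> A" "\<phi> B = \<psi> B"
      using loc AB unfolding local_automorphism_GL_iff by metis
    interpret \<psi>: gl_aut \<psi> by (rule \<psi>(1))
    obtain U g where U: "invertible U" "g \<in> Mr1 CARD('n)"
      and form: "(\<forall>A. invertible A \<longrightarrow> \<psi> A = g (det A) *\<^sub>R conjm U A) \<or>
        (\<forall>A. invertible A \<longrightarrow> contragr (\<psi> A) = g (det A) *\<^sub>R conjm U A)"
      using \<psi>.automorphism_form[OF n] by blast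
    from form show "\<exists>T g. invertible T \<and> g \<in> Mr1 CARD('n) \<and>
      (conjm ?S (\<phi> A) = g (det A) *\<^sub>R conjm T A \<and> conjm ?S (\<phi> B) = g (det B) *\<^sub>R conjm T B \<or>
       conjm ?S (\<phi> A) = inverse (g (det A)) *\<^sub>R conjm T (contragr A) \<and>
       conjm ?S (\<phi> B) = inverse (g (det B)) *\<^sub>R conjm T (contragr B))"
    proof
      assume "\<forall>A. invertible A \<longrightarrow> \<psi> A = g (det A) *\<^sub>R conjm U A"
      then show ?thesis using U S AB
        by (intro exI[of _ "?S ** U"] exI[of _ g])
          (simp add: \<psi>(2,3) invertible_mult conjm_scaleR conjm_conjm)
    next
      assume *: "\<forall>A. invertible A \<longrightarrow> contragr (\<psi> A) = g (det A) *\<^sub>R conjm U A"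
      have "\<psi> A = inverse (g (det A)) *\<^sub>R conjm (contragr U) (contragr A)" if A: "invertible A" for A
      proof -
        have "g (det A) \<noteq> 0" using Mr1_D(1)[OF U(2)] A by (simp add: invertible_det_nz)
        moreover have "\<psi> A = contragr (g (det A) *\<^sub>R conjm U A)"
          using * A by (metis \<psi>.invertible_image contragr_contragr)
        ultimately show ?thesis using A U(1) by (simp add: contragr_scaleR contragr_conjm)
      qed
      then show ?thesis using U S AB
        by (intro exI[of _ "?S ** contragr U"] exI[of _ g])
          (simp add: \<psi>(2,3) invertible_mult conjm_scaleR conjm_conjm)
    qed
  next
    show "conjm ?S (\<phi> (diagm d)) = c *\<^sub>R diagm d"
      using T by (simp add: base conjm_scaleR)
  qed (use n d c in auto)
  obtain U f where U: "invertible U" "f \<in> LMr1 CARD('n)"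
    "\<And>A. invertible A \<Longrightarrow> conjm ?S (\<phi> A) = f (det A) *\<^sub>R conjm U A"
    using L.global_form by blast
  have "\<phi> A = f (det A) *\<^sub>R conjm (T ** U) A" if "invertible A" for A
    using conjm_inv_cancel(2)[OF T, of "\<phi> A"] U(1) T
    by (simp add: U(3)[OF that] conjm_scaleR conjm_conjm)
  then show ?thesis using U T unfolding twist_form_def
    by (intro exI[of _ "T ** U"] exI[of _ f]) (simp add: invertible_mult)
qed

text \<open>An automorphism agreeing with \<open>\<phi>\<close> at one rigid diagonal matrix decides
  the alternative. In the second case the argument is applied to the contragredient of
  \<open>\<phi>\<close>, again a local automorphism.\<close>

lemma local_automorphism_GL_form:
  fixes \<phi> :: "real^'n^'n \<Rightarrow> real^'n^'n"
  assumes n: "CARD('n) \<ge> 3" and maps: "\<And>A. invertible A \<Longrightarrow> invertible (\<phi> A)"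
  shows "local_automorphism GL \<phi> \<longleftrightarrow> twist_form \<phi> \<or> twist_form (\<lambda>A. contragr (\<phi> A))"
proof
  assume loc: "local_automorphism GL \<phi>"
  obtain d :: "'n \<Rightarrow> real" where d: "inj d" "rigid (diagm d :: real^'n^'n)"
    using ex_rigid_distinct_diag[OF n] by blast
  then have D: "invertible (diagm d :: real^'n^'n)" by (simp add: rigid_def)
  then obtain \<psi> where \<psi>: "gl_aut \<psi>" "\<phi> (diagm d) = \<psi> (diagm d)"
    using loc unfolding local_automorphism_GL_iff by metis
  interpret \<psi>: gl_aut \<psi> by (rule \<psi>(1))
  obtain U g where U: "invertible U" "g \<in> Mr1 CARD('n)"
    and form: "(\<forall>A. invertible A \<longrightarrow> \<psi> A = g (det A) *\<^sub>R conjm U A) \<or>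
      (\<forall>A. invertible A \<longrightarrow> contragr (\<psi> A) = g (det A) *\<^sub>R conjm U A)"
    using \<psi>.automorphism_form[OF n] by blast
  have g: "g (det (diagm d :: real^'n^'n)) \<noteq> 0"
    using Mr1_D(1)[OF U(2)] D by (simp add: invertible_det_nz)
  from form show "twist_form \<phi> \<or> twist_form (\<lambda>A. contragr (\<phi> A))"
  proof
    assume "\<forall>A. invertible A \<longrightarrow> \<psi> A = g (det A) *\<^sub>R conjm U A"
    then show ?thesis using twist_form_of_normalized[OF n loc d U(1) g] D \<psi>(2) by simp
  next
    assume "\<forall>A. invertible A \<longrightarrow> contragr (\<psi> A) = g (det A) *\<^sub>R conjm U A"
    then show ?thesis
      using twist_form_of_normalized[OF n local_automorphism_contragr[OF loc] d U(1) g] D \<psi>(2) by simp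
  qed
next
  assume "twist_form \<phi> \<or> twist_form (\<lambda>A. contragr (\<phi> A))"
  then show "local_automorphism GL \<phi>"
  proof
    assume "twist_form (\<lambda>A. contragr (\<phi> A))"
    then have "local_automorphism GL (\<lambda>A. contragr (contragr (\<phi> A)))"
      by (intro local_automorphism_contragr local_automorphism_twist_form)
    then show ?thesis by (rule local_automorphism_cong) (simp add: maps)
  qed (rule local_automorphism_twist_form)
qed

lemma LMr1_nonzero: "f \<in> LMr1 n \<Longrightarrow> x \<noteq> 0 \<Longrightarrow> f x \<noteq> 0"
  by (auto simp: LMr1_def locally_in_def Rstar_def)

text \<open>The contragredient map is an involution on invertible matrices and inverts scalars, so
  it trades \<open>LMr1\<close> for \<open>LMr2\<close> and \<open>T\<close> for its
  contragredient.\<close>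

lemma twist_form_contragr_iff:
  fixes \<phi> :: "real^'n^'n \<Rightarrow> real^'n^'n"
  assumes maps: "\<And>A. invertible A \<Longrightarrow> invertible (\<phi> A)"
  shows "twist_form (\<lambda>A. contragr (\<phi> A)) \<longleftrightarrow> (\<exists>T f. invertible T \<and> f \<in> LMr2 CARD('n) \<and>
    (\<forall>A. invertible A \<longrightarrow> \<phi> A = f (det A) *\<^sub>R conjm T (contragr A)))"
proof
  assume "twist_form (\<lambda>A. contragr (\<phi> A))"
  then obtain T f where T: "invertible T" and f: "f \<in> LMr1 CARD('n)"
    and form: "\<And>A. invertible A \<Longrightarrow> contragr (\<phi> A) = f (det A) *\<^sub>R conjm T A"
    unfolding twist_form_def by blast
  have "\<phi> A = inverse (f (det A)) *\<^sub>R conjm (contragr T) (contragr A)" if A: "invertible A" for A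
  proof -
    have "f (det A) \<noteq> 0" using LMr1_nonzero[OF f] A by (simp add: invertible_det_nz)
    then show ?thesis
      using arg_cong[OF form[OF A], of contragr] A T by (simp add: maps contragr_scaleR contragr_conjm)
  qed
  then show "\<exists>T f. invertible T \<and> f \<in> LMr2 CARD('n) \<and>
    (\<forall>A. invertible A \<longrightarrow> \<phi> A = f (det A) *\<^sub>R conjm T (contragr A))"
    using T f by (intro exI[of _ "contragr T"] exI[of _ "\<lambda>x. inverse (f x)"]) (simp add: LMr2_iff)
next
  assume "\<exists>T f. invertible T \<and> f \<in> LMr2 CARD('n) \<and>
    (\<forall>A. invertible A \<longrightarrow> \<phi> A = f (det A) *\<^sub>R conjm T (contragr A))"
  then obtain T f where T: "invertible T" and f: "(\<lambda>x. inverse (f x)) \<in> LMr1 CARD('n)"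
    and form: "\<And>A. invertible A \<Longrightarrow> \<phi> A = f (det A) *\<^sub>R conjm T (contragr A)"
    unfolding LMr2_iff by blast
  have "contragr (\<phi> A) = inverse (f (det A)) *\<^sub>R conjm (contragr T) A" if A: "invertible A" for A
  proof -
    have "f (det A) \<noteq> 0" using LMr1_nonzero[OF f] A by (simp add: invertible_det_nz)
    then show ?thesis using A T by (simp add: form contragr_scaleR contragr_conjm)
  qed
  then show "twist_form (\<lambda>A. contragr (\<phi> A))" unfolding twist_form_def
    using T f by (intro exI[of _ "contragr T"] exI[of _ "\<lambda>x. inverse (f x)"]) simp
qed

theorem theorem3p7:
  fixes \<phi> :: "real ^ 'n ^ 'n \<Rightarrow> real ^ 'n ^ 'n"
  assumes "CARD('n) \<ge> 3"
    and "\<phi> \<in> carrier GL \<rightarrow> carrier GL"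
  shows "local_automorphism GL \<phi> \<longleftrightarrow>
    (\<exists>T\<in>carrier GL. \<exists>f\<in>LMr1 CARD('n). \<forall>A\<in>carrier GL.
        \<phi> A = f (det A) *\<^sub>R (T ** A ** matrix_inv T)) \<or>
    (\<exists>T\<in>carrier GL. \<exists>f\<in>LMr2 CARD('n). \<forall>A\<in>carrier GL.
        \<phi> A = f (det A) *\<^sub>R (T ** transpose (matrix_inv A) ** matrix_inv T))"
proof -
  have carrier: "carrier GL = {A :: real^'n^'n. invertible A}" by (simp add: GL_def)
  have maps: "invertible (\<phi> A)" if "invertible A" for A
    using assms(2) that by (auto simp: carrier)
  have "local_automorphism GL \<phi> \<longleftrightarrow> twist_form \<phi> \<or> twist_form (\<lambda>A. contragr (\<phi> A))"
    by (rule local_automorphism_GL_form[OF assms(1) maps])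
  also have "twist_form (\<lambda>A. contragr (\<phi> A)) \<longleftrightarrow> (\<exists>T f. invertible T \<and> f \<in> LMr2 CARD('n) \<and>
    (\<forall>A. invertible A \<longrightarrow> \<phi> A = f (det A) *\<^sub>R conjm T (contragr A)))"
    by (rule twist_form_contragr_iff[OF maps])
  finally show ?thesis
    by (simp only: twist_form_def carrier conjm_def contragr_def Bex_def Ball_def mem_Collect_eq ex_simps)
qed

end
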